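(* Let $n$ be a positive integer. Every graph in $\mathcal{F}_n$ has at most one generalized cospectral mate, up to isomorphism (i.e., any two graphs that are generalized cospectral with $G\in\mathcal{F}_n$ but not isomorphic to $G$ are isomorphic to each other).
   Context: All graphs are finite, simple and undirected. For a graph $G$ on $n$ vertices with adjacency matrix $A$, the walk matrix is $W=W(G)=[e,Ae,\ldots,A^{n-1}e]$, where $e$ is the all-one column vector. The generalized spectrum of $G$ is the pair consisting of the spectrum of $A$ and the spectrum of $J-I-A$ (the adjacency matrix of the complement), where $J$ is the all-one matrix. Two graphs are generalized cospectral if they have the same generalized spectrum; a generalized cospectral mate of $G$ is a graph generalized cospectral with $G$ but not isomorphic to $G$. $\mathcal{F}_n$ denotes the family of all graphs $G$ on $n$ vertices such that the Smith normal form of $W(G)$ is $\mathrm{diag}[1,\ldots,1,2,\ldots,2,2p^2b]$, with $\lceil n/2\rceil$ entries equal to $1$ followed by $\lfloor n/2\rfloor$ entries $2,\ldots,2,2p^2b$ (the last being $2p^2b$), where $b$ is an odd square-free integer, $p$ is an odd prime and $p\nmid b$. *)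

theory Defs
  imports
    "Graph_Theory.Pair_Digraph"
    "Graph_Theory.Digraph_Isomorphism"
    "Jordan_Normal_Form.Char_Poly"
    "HOL-Computational_Algebra.Squarefree"
begin

text \<open>
  A finite simple undirected graph is a \<^const>\<open>pair_graph\<close>: a finite, loop-free, symmetric
  digraph whose arcs are pairs of vertices.
\<close>

text \<open>
  Matrices of a graph are taken with respect to an arbitrary enumeration of its vertices.  Another
  enumeration conjugates the adjacency matrix by a permutation matrix and permutes the rows of the
  walk matrix, which changes neither the spectra nor the Smith normal form.
\<close>

definition vertex_list :: "'a pair_pre_digraph \<Rightarrow> 'a list" where
  "vertex_list G = (SOME vs. distinct vs \<and> set vs = pverts G)"

definition adjacency_mat :: "'a pair_pre_digraph \<Rightarrow> int mat" where
  "adjacency_mat G = (let n = card (pverts G); vs = vertex_list G in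
     mat n n (\<lambda>(i, j). if (vs ! i, vs ! j) \<in> parcs G then 1 else 0))"

definition all_ones_vec :: "nat \<Rightarrow> int vec" where
  "all_ones_vec n = vec n (\<lambda>_. 1)"

definition all_ones_mat :: "nat \<Rightarrow> int mat" where
  "all_ones_mat n = mat n n (\<lambda>_. 1)"

definition complement_mat :: "'a pair_pre_digraph \<Rightarrow> int mat" where
  "complement_mat G = (let n = card (pverts G) in
     all_ones_mat n - 1\<^sub>m n - adjacency_mat G)"

definition walk_mat :: "'a pair_pre_digraph \<Rightarrow> int mat" where
  "walk_mat G = (let n = card (pverts G) in
     mat_of_cols n (map (\<lambda>k. (adjacency_mat G ^\<^sub>m k) *\<^sub>v all_ones_vec n) [0..<n]))"

definition spectrum_mset :: "int mat \<Rightarrow> complex multiset" where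
  "spectrum_mset M = proots (char_poly (map_mat of_int M))"

definition generalized_spectrum :: "'a pair_pre_digraph \<Rightarrow> complex multiset \<times> complex multiset" where
  "generalized_spectrum G = (spectrum_mset (adjacency_mat G), spectrum_mset (complement_mat G))"

definition generalized_cospectral :: "'a pair_pre_digraph \<Rightarrow> 'b pair_pre_digraph \<Rightarrow> bool" where
  "generalized_cospectral G H \<longleftrightarrow> generalized_spectrum G = generalized_spectrum H"

definition graph_isomorphic :: "'a pair_pre_digraph \<Rightarrow> 'b pair_pre_digraph \<Rightarrow> bool" where
  "graph_isomorphic G H \<longleftrightarrow> digraph_iso (with_proj G) (with_proj H)"

definition generalized_cospectral_mate :: "'a pair_pre_digraph \<Rightarrow> 'b pair_pre_digraph \<Rightarrow> bool" where
  "generalized_cospectral_mate G H \<longleftrightarrow>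
     pair_graph H \<and> generalized_cospectral G H \<and> \<not> graph_isomorphic G H"

definition is_smith_normal_form :: "int mat \<Rightarrow> int mat \<Rightarrow> bool" where
  "is_smith_normal_form M S \<longleftrightarrow>
     S \<in> carrier_mat (dim_row M) (dim_col M) \<and>
     diagonal_mat S \<and>
     (\<forall>i < min (dim_row M) (dim_col M). 0 \<le> S $$ (i, i)) \<and>
     (\<forall>i. Suc i < min (dim_row M) (dim_col M) \<longrightarrow> S $$ (i, i) dvd S $$ (Suc i, Suc i)) \<and>
     (\<exists>U V. U \<in> carrier_mat (dim_row M) (dim_row M) \<and> invertible_mat U \<and>
            V \<in> carrier_mat (dim_col M) (dim_col M) \<and> invertible_mat V \<and>
            S = U * M * V)"

text \<open>
  Since \<^const>\<open>is_smith_normal_form\<close> requires nonnegative entries, \<open>b\<close> is positive when \<open>n \<ge> 2\<close>.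
  For \<open>n = 1\<close> the list below is \<open>[1]\<close>, as there are no entries after the \<open>\<lceil>n/2\<rceil>\<close> ones.
\<close>

definition graph_family :: "nat \<Rightarrow> 'a pair_pre_digraph set" where
  "graph_family n = {G. pair_graph G \<and> card (pverts G) = n \<and>
     (\<exists>p b :: int. prime p \<and> odd p \<and> odd b \<and> squarefree b \<and> \<not> p dvd b \<and>
        is_smith_normal_form (walk_mat G)
          (mk_diagonal (map (\<lambda>i. if i < (n + 1) div 2 then 1
                                 else if i < n - 1 then 2
                                 else 2 * p\<^sup>2 * b) [0..<n])))}"

lemma vertex_list:
  assumes "finite (pverts G)"
  shows "distinct (vertex_list G)" "set (vertex_list G) = pverts G"
  using someI_ex[of "\<lambda>vs. distinct vs \<and> set vs = pverts G"] finite_distinct_list[OF assms]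
  by (auto simp: vertex_list_def)

lemma graph_isomorphic_iff:
  assumes "pair_graph G" "pair_graph H"
  shows "graph_isomorphic G H \<longleftrightarrow>
    (\<exists>f. bij_betw f (pverts G) (pverts H) \<and>
         (\<forall>u\<in>pverts G. \<forall>v\<in>pverts G. (u, v) \<in> parcs G \<longleftrightarrow> (f u, f v) \<in> parcs H))"
    (is "?L \<longleftrightarrow> ?R")
proof
  interpret G: pair_graph G by fact
  assume ?L
  then obtain h where h: "pre_digraph.digraph_isomorphism (with_proj G) h"
    and H: "with_proj H = app_iso h (with_proj G)"
    unfolding graph_isomorphic_def digraph_iso_def by blast
  let ?f = "iso_verts h"
  have V: "pverts H = ?f ` pverts G" and A: "parcs H = iso_arcs h ` parcs G"
    and t: "iso_tail h = fst" and hd: "iso_head h = snd"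
    using H by (simp_all add: with_proj_def app_iso_def)
  have inj: "inj_on ?f (pverts G)"
    and ends: "\<And>a. a \<in> parcs G \<Longrightarrow> iso_arcs h a = (?f (fst a), ?f (snd a))"
    using h by (auto simp: pre_digraph.digraph_isomorphism_def t hd prod_eq_iff)
  have "(u, v) \<in> parcs G \<longleftrightarrow> (?f u, ?f v) \<in> parcs H" if "u \<in> pverts G" "v \<in> pverts G" for u v
  proof
    assume "(u, v) \<in> parcs G"
    then show "(?f u, ?f v) \<in> parcs H" using ends A by force
  next
    assume "(?f u, ?f v) \<in> parcs H"
    then obtain a where a: "a \<in> parcs G" "(?f u, ?f v) = (?f (fst a), ?f (snd a))"
      using A ends by auto
    then have "u = fst a" "v = snd a"
      using inj that G.arc_fst_in_verts G.arc_snd_in_verts by (auto dest: inj_onD)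
    then show "(u, v) \<in> parcs G" using a by simp
  qed
  then show ?R using inj V by (intro exI[of _ ?f]) (auto simp: bij_betw_def)
next
  interpret G: pair_graph G by fact
  interpret H: pair_graph H by fact
  assume ?R
  then obtain f where f: "bij_betw f (pverts G) (pverts H)"
    and e: "\<And>u v. u \<in> pverts G \<Longrightarrow> v \<in> pverts G \<Longrightarrow> (u, v) \<in> parcs G \<longleftrightarrow> (f u, f v) \<in> parcs H"
    by blast
  let ?h = "\<lparr>iso_verts = f, iso_arcs = map_prod f f, iso_head = snd, iso_tail = fst\<rparr>"
  have inj: "inj_on f (pverts G)" and im: "f ` pverts G = pverts H"
    using f by (auto simp: bij_betw_def)
  have sub: "parcs G \<subseteq> pverts G \<times> pverts G"
    using G.arc_fst_in_verts G.arc_snd_in_verts by force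
  have "inj_on (map_prod f f) (parcs G)"
    using map_prod_inj_on[OF inj inj] sub by (rule inj_on_subset)
  then have 1: "pre_digraph.digraph_isomorphism (with_proj G) ?h"
    using inj G.wf_digraph by (auto simp: pre_digraph.digraph_isomorphism_def)
  have "map_prod f f ` parcs G = parcs H"
  proof (intro equalityI subsetI)
    fix a assume "a \<in> map_prod f f ` parcs G"
    then show "a \<in> parcs H" using sub e by auto
  next
    fix a assume a: "a \<in> parcs H"
    then have "fst a \<in> f ` pverts G" "snd a \<in> f ` pverts G"
      using im H.arc_fst_in_verts H.arc_snd_in_verts by auto
    then obtain u v where "u \<in> pverts G" "v \<in> pverts G" "a = (f u, f v)"
      by (cases a) auto
    then show "a \<in> map_prod f f ` parcs G" using a e by force
  qed
  then have "with_proj H = app_iso ?h (with_proj G)"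
    using im by (simp add: with_proj_def app_iso_def)
  then show ?L unfolding graph_isomorphic_def digraph_iso_def
    by (intro exI[of _ ?h] conjI 1)
qed

end

theory Submission
  imports Defs "HOL-Library.Z2"
begin

text \<open>
  Let \<open>M\<close> be the lattice spanned by the vectors \<open>A\<^sup>k e\<close>. A graph that is generalized cospectral with
  \<open>G\<close> corresponds to an \<open>A\<close>-invariant unimodular lattice between \<open>M\<close> and its dual \<open>M\<^sup>#\<close>, and equal
  lattices give isomorphic graphs, because an integral orthogonal matrix fixing \<open>e\<close> is a permutation
  matrix. The dual \<open>M\<^sup>#\<close> is a cyclic module over \<open>\<int>[x]\<close>, generated by the last column \<open>f\<close> of the
  inverse transposed walk matrix, so these lattices become ideals of \<open>\<int>[x]\<close>, and unimodularity
  says that the ideal equals its own annihilator modulo the ideal of \<open>M\<close>. At the prime 2, the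
  vanishing diagonal of \<open>A\<close> gives \<open>2 M\<^sup># \<subseteq> M\<close>, so the quotient ring is \<open>F\<^sub>2[x]/(h)\<close> and the ideal is
  generated by the unique square root of \<open>h\<close>. At odd primes \<open>\<int>\<^sup>n/M\<close> is a cyclic group; this
  leaves one ideal at a prime dividing \<open>b\<close> and, since a hyperbolic plane has two isotropic lines, at most
  two ideals at \<open>p\<close>.
\<close>

subsection \<open>Self-annihilating ideals\<close>

text \<open>Everything rational is scaled to stay integral: \<open>f\<close> is \<open>z\<close> /
  \<open>N\<close>, and denominators become divisibility by \<open>N\<close>. The ideal of
  \<open>M\<close> is written only in terms of the numbers e^T q(A) e. The generalized spectrum
  fixes these numbers, and one pair \<open>r\<close>, \<open>N\<close> obtained from the Gram matrix
  of the walks serves all three graphs. Hence G and its mates give three ideals of one ring,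
  self-annihilating for the same \<open>m\<close>, and no orthogonal matrix between two graphs has
  to be built beforehand. The Smith normal form enters through G alone; congruences reach a mate
  with ideal J because u in J forces u^2 into \<open>m\<close>, which is contained in the ideal I of
  G. The primes are separated without localized rings: at 2 a product is controlled up to an odd
  factor, away from 2 up to a power of 2, and Bezout joins the two. The ideal of G already occupies
  one of the two isotropic lines at \<open>p\<close>, so a mate with a different ideal must occupy
  the other one; this is why one mate remains.\<close>

definition ring_ideal :: "'a :: comm_ring_1 set \<Rightarrow> bool" where
  "ring_ideal I \<longleftrightarrow> 0 \<in> I \<and> (\<forall>u\<in>I. \<forall>v\<in>I. u + v \<in> I) \<and> (\<forall>u\<in>I. \<forall>r. r * u \<in> I)"

definition self_annihilating :: "'a :: comm_ring_1 set \<Rightarrow> 'a set \<Rightarrow> bool" where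
  "self_annihilating m I \<longleftrightarrow> ring_ideal I \<and> (\<forall>u. u \<in> I \<longleftrightarrow> (\<forall>v\<in>I. u * v \<in> m))"

lemma ring_idealD:
  assumes "ring_ideal I"
  shows "0 \<in> I" "\<And>u v. u \<in> I \<Longrightarrow> v \<in> I \<Longrightarrow> u + v \<in> I"
    "\<And>u r. u \<in> I \<Longrightarrow> r * u \<in> I" "\<And>u r. u \<in> I \<Longrightarrow> u * r \<in> I"
    "\<And>u v. u \<in> I \<Longrightarrow> v \<in> I \<Longrightarrow> u - v \<in> I"
proof -
  show "0 \<in> I" and add: "\<And>u v. u \<in> I \<Longrightarrow> v \<in> I \<Longrightarrow> u + v \<in> I"
    and mul: "\<And>u r. u \<in> I \<Longrightarrow> r * u \<in> I"
    using assms by (auto simp: ring_ideal_def)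
  show "\<And>u r. u \<in> I \<Longrightarrow> u * r \<in> I" using mul by (simp add: mult.commute)
  fix u v assume "u \<in> I" "v \<in> I"
  then have "u + (- 1) * v \<in> I" using add mul by blast
  then show "u - v \<in> I" by simp
qed

lemma self_annihilatingD:
  assumes "self_annihilating m I"
  shows "ring_ideal I" "\<And>u v. u \<in> I \<Longrightarrow> v \<in> I \<Longrightarrow> u * v \<in> m"
    "\<And>u. (\<And>v. v \<in> I \<Longrightarrow> u * v \<in> m) \<Longrightarrow> u \<in> I"
  using assms unfolding self_annihilating_def by blast+

text \<open>Each ideal is the full annihilator of itself, so mutual annihilation gives both
  inclusions. All later comparisons of ideals are thereby reduced to membership of products in
  \<open>m\<close>.\<close>

lemma self_annihilating_eqI:
  assumes "self_annihilating m I" "self_annihilating m J"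
    and "\<And>u v. u \<in> I \<Longrightarrow> v \<in> J \<Longrightarrow> u * v \<in> m"
  shows "I = J"
proof (intro equalityI subsetI)
  fix u assume "u \<in> I"
  then show "u \<in> J" using self_annihilatingD(3)[OF assms(2)] assms(3) by blast
next
  fix u assume "u \<in> J"
  then show "u \<in> I" using self_annihilatingD(3)[OF assms(1)] assms(3) by (metis mult.commute)
qed

lemma ring_ideal_scaled:
  assumes "ring_ideal m"
  shows "ring_ideal {u. c * u \<in> m}"
  using ring_idealD[OF assms] by (auto simp: ring_ideal_def distrib_left mult.left_commute[of c])

lemma ring_ideal_poly_principal:
  fixes I :: "'a :: field poly set"
  assumes I: "ring_ideal I"
  obtains g where "I = {u. g dvd u}"
proof (cases "I = {0}")
  case True
  then have "I = {u. 0 dvd u}" by auto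
  then show ?thesis using that by blast
next
  case False
  then obtain u0 where "u0 \<in> I \<and> u0 \<noteq> 0" using ring_idealD(1)[OF I] by blast
  then obtain g where g: "g \<in> I \<and> g \<noteq> 0"
    and min: "\<And>u. u \<in> I \<and> u \<noteq> 0 \<Longrightarrow> degree g \<le> degree u"
    using ex_has_least_nat[of "\<lambda>u. u \<in> I \<and> u \<noteq> 0" u0 degree] by blast
  have "g dvd u" if "u \<in> I" for u
  proof (rule ccontr)
    assume "\<not> g dvd u"
    then have nz: "u mod g \<noteq> 0" by (simp add: dvd_eq_mod_eq_0)
    have "u - g * (u div g) \<in> I" using that g I by (blast intro: ring_idealD)
    then have "u mod g \<in> I" by (simp add: minus_mult_div_eq_mod)
    then have "degree g \<le> degree (u mod g)" using min nz by blast
    then show False using degree_mod_less[of g u] g nz by auto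
  qed
  moreover have "u \<in> I" if "g dvd u" for u
    using that g I by (auto elim!: dvdE intro: ring_idealD)
  ultimately have "I = {u. g dvd u}" by auto
  then show ?thesis by (rule that)
qed

section \<open>Reduction of ideals modulo 2\<close>

lemma bit_poly_dvd_antisym:
  fixes g h :: "bit poly"
  assumes "g dvd h" "h dvd g"
  shows "g = h"
proof (cases "g = 0")
  case False
  then have "h \<noteq> 0" using assms by auto
  then have "lead_coeff g = 1" "lead_coeff h = 1" using False
    by (metis bit_not_one_iff leading_coeff_0_iff)+
  then show ?thesis using assms by (intro poly_dvd_antisym) auto
qed (use assms in auto)

abbreviation poly_mod2 :: "int poly \<Rightarrow> bit poly" where
  "poly_mod2 \<equiv> map_poly of_int"

lemma poly_mod2_hom:
  "poly_mod2 (u + v) = poly_mod2 u + poly_mod2 v"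
  "poly_mod2 (u * v) = poly_mod2 u * poly_mod2 v"
  "poly_mod2 (u - v) = poly_mod2 u - poly_mod2 v"
  by (simp_all add: hom_distribs)

lemma of_int_bit_eq_0_iff: "(of_int k :: bit) = 0 \<longleftrightarrow> even k"
proof -
  have *: "(of_int (2 * j) :: bit) = 0" for j by simp
  show ?thesis
  proof (cases "even k")
    case True then show ?thesis using * by (auto elim: evenE)
  next
    case False
    then obtain j where "k = 2 * j + 1" by (auto elim: oddE)
    then have "(of_int k :: bit) = 1" using *[of j] by (simp only: of_int_add of_int_1 add_0)
    then show ?thesis using False by simp
  qed
qed

lemma poly_mod2_eq_0D:
  assumes "poly_mod2 u = 0"
  obtains r where "u = 2 * r"
proof -
  have "even (coeff u i)" for i
    using arg_cong[OF assms, of "\<lambda>q. coeff q i"] by (simp add: coeff_map_poly of_int_bit_eq_0_iff)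
  then have "[:2:] dvd u" by (simp add: const_poly_dvd_iff)
  then show ?thesis using that by (auto elim!: dvdE simp: numeral_poly)
qed

lemma poly_mod2_surj: "\<exists>u. poly_mod2 u = w"
proof -
  let ?lift = "\<lambda>c :: bit. if c = 0 then 0 else 1 :: int"
  have "poly_mod2 (map_poly ?lift w) = w"
    by (rule poly_eqI) (auto simp: coeff_map_poly)
  then show ?thesis by blast
qed

lemma poly_mod2_image_ideal:
  assumes "ring_ideal I"
  shows "ring_ideal (poly_mod2 ` I)"
  unfolding ring_ideal_def
proof (intro conjI ballI allI)
  show "0 \<in> poly_mod2 ` I" using ring_idealD(1)[OF assms] by force
  show "u + v \<in> poly_mod2 ` I" if "u \<in> poly_mod2 ` I" "v \<in> poly_mod2 ` I" for u v
    using that ring_idealD(2)[OF assms] by (force simp: poly_mod2_hom(1)[symmetric])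
  show "r * u \<in> poly_mod2 ` I" if "u \<in> poly_mod2 ` I" for u r
    using that ring_idealD(3)[OF assms] poly_mod2_surj[of r] by (force simp: poly_mod2_hom(2)[symmetric])
qed

text \<open>The ideal of all u with \<open>of_int c * u\<close> in \<open>m\<close> contains 2, so
  it is determined by its reduction (h). Self-annihilation then becomes a statement in F_2[x]: h
  divides w g exactly when g divides w. This forces h = g^2.\<close>

lemma self_annihilating_mod2_generator:
  fixes m I :: "int poly set" and c :: int
  assumes m: "ring_ideal m" and c: "odd c" "of_int (2 * c) \<in> m"
    and h: "poly_mod2 ` {u. of_int c * u \<in> m} = {u. h dvd u}"
    and I: "self_annihilating m I"
  obtains g where "poly_mod2 ` I = {u. g dvd u}" "h = g * g"
proof -
  obtain g where g: "poly_mod2 ` I = {u. g dvd u}"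
    using ring_ideal_poly_principal[OF poly_mod2_image_ideal] self_annihilatingD(1)[OF I] by metis
  have mem: "of_int c * w \<in> m" if hw: "h dvd poly_mod2 w" for w
  proof -
    have "poly_mod2 w \<in> poly_mod2 ` {u. of_int c * u \<in> m}" using h hw by simp
    then obtain u where u: "of_int c * u \<in> m" "poly_mod2 w = poly_mod2 u" by auto
    then obtain r where r: "w - u = 2 * r" using poly_mod2_eq_0D[of "w - u"] poly_mod2_hom(3) by auto
    have "of_int c * w = of_int c * u + of_int (2 * c) * r"
      using arg_cong[OF r, of "\<lambda>x. of_int c * (u + x)"] by (simp add: algebra_simps)
    then show ?thesis using u c m by (simp add: ring_idealD)
  qed
  have c1: "poly_mod2 (of_int c * w) = poly_mod2 w" for w
  proof -
    have "(of_int c :: bit) = 1" using c(1) of_int_bit_eq_0_iff[of c] by simp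
    then show ?thesis by (intro poly_eqI) (simp add: coeff_map_poly of_int_poly)
  qed
  \<comment> \<open>The odd factor \<open>c\<close> moves the lift \<open>w'\<close> into I, and it
    disappears again modulo 2 by \<open>c1\<close>.\<close>
  have colon: "g dvd w" if hw: "h dvd w * g" for w
  proof -
    obtain w' where w': "poly_mod2 w' = w" using poly_mod2_surj by blast
    have "of_int c * w' \<in> I"
    proof (rule self_annihilatingD(3)[OF I])
      fix v assume "v \<in> I"
      then have "g dvd poly_mod2 v" using g by auto
      then have "h dvd poly_mod2 (w' * v)" 
        using dvd_trans[OF hw mult_dvd_mono[OF dvd_refl]] w' by (simp add: poly_mod2_hom)
      then show "of_int c * w' * v \<in> m" using mem by (simp add: mult.assoc)
    qed
    then have "poly_mod2 (of_int c * w') \<in> poly_mod2 ` I" by blast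
    then show ?thesis using c1 g w' by auto
  qed
  have "g \<in> poly_mod2 ` I" using g by simp
  then obtain u where u: "u \<in> I" "g = poly_mod2 u" by auto
  have "u * u \<in> {u. of_int c * u \<in> m}" using u I m by (auto intro: ring_idealD self_annihilatingD)
  then have "poly_mod2 (u * u) \<in> {u. h dvd u}" using h by blast
  then have 1: "h dvd g * g" using u by (simp add: poly_mod2_hom)
  have "g dvd h" by (rule colon) simp
  then obtain t where t: "h = g * t" by blast
  then have "g dvd t" using colon by (simp add: mult.commute)
  then have "g * g dvd h" using t by simp
  then have "h = g * g" using 1 by (intro bit_poly_dvd_antisym)
  then show ?thesis by (rule that[OF g])
qed

text \<open>In \<open>F\<^sub>2[x]\<close> a self-annihilating ideal modulo \<open>(h)\<close> is generated by a square root of \<open>h\<close>,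
  and square roots are unique in characteristic 2.\<close>

lemma self_annihilating_product_at_two:
  fixes m I J :: "int poly set" and c :: int
  assumes m: "ring_ideal m" and c: "odd c" "of_int (2 * c) \<in> m"
    and I: "self_annihilating m I" and J: "self_annihilating m J"
    and u: "u \<in> I" and v: "v \<in> J"
  shows "\<exists>c. odd c \<and> of_int c * (u * v) \<in> m"
proof -
  let ?m = "{u. of_int c * u \<in> m}"
  obtain h where h: "poly_mod2 ` ?m = {u. h dvd u}"
    using ring_ideal_poly_principal[OF poly_mod2_image_ideal] ring_ideal_scaled[OF m] by metis
  obtain g where g: "poly_mod2 ` I = {u. g dvd u}" "h = g * g"
    using self_annihilating_mod2_generator[OF m c h I] .
  obtain g' where g': "poly_mod2 ` J = {u. g' dvd u}" "h = g' * g'"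
    using self_annihilating_mod2_generator[OF m c h J] .
  have "(g - g') * (g - g') = g * g + g' * g' - 2 * (g * g')" by (simp add: algebra_simps)
  also have "\<dots> = h + h" using g g' by (simp add: numeral_poly)
  also have "\<dots> = 0" by (simp add: numeral_poly)
  finally have "g = g'" by simp
  then have "h dvd poly_mod2 u * poly_mod2 v" using g g' u v by (auto intro!: mult_dvd_mono)
  then have "poly_mod2 (u * v) \<in> poly_mod2 ` ?m" using h by (simp add: poly_mod2_hom)
  then obtain w where w: "of_int c * w \<in> m" "poly_mod2 (u * v) = poly_mod2 w" by auto
  then obtain r where r: "u * v - w = 2 * r"
    using poly_mod2_eq_0D[of "u * v - w"] poly_mod2_hom(3) by auto
  have "of_int c * (u * v) = of_int c * w + of_int (2 * c) * r"
    using arg_cong[OF r, of "\<lambda>x. of_int c * (w + x)"] by (simp add: algebra_simps)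
  then show ?thesis using w c m by (auto simp: ring_idealD)
qed


section \<open>Self-annihilating ideals away from the prime 2\<close>

lemma squarefree_dvd_square:
  fixes b x :: int
  assumes b: "squarefree b" and dvd: "b dvd x\<^sup>2"
  shows "b dvd x"
proof -
  have "b \<noteq> 0" using b by auto
  then have g: "gcd b x \<noteq> 0" by simp
  obtain b' x' where b': "b = b' * gcd b x" and x': "x = x' * gcd b x" and cop: "coprime b' x'"
    using gcd_coprime_exists[OF g] by metis
  have "gcd b x * b' dvd gcd b x * (x'\<^sup>2 * gcd b x)"
    using dvd b' x' by (metis mult.commute mult.left_commute power2_eq_square)
  then have "b' dvd x'\<^sup>2 * gcd b x" using g by (simp only: dvd_mult_cancel_left) blast
  then have "b' dvd gcd b x" using cop by (simp add: coprime_dvd_mult_right_iff)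
  then have "b'\<^sup>2 dvd b" using b' by (metis mult_dvd_mono dvd_refl power2_eq_square)
  then have "is_unit b'" using b squarefreeD by blast
  then show ?thesis using b' by (metis dvd_trans gcd_dvd2 mult_unit_dvd_iff' dvd_refl)
qed

text \<open>A Bezout combination of the two multiples is u. This glues information at different
  primes: powers of 2 with odd numbers, and powers of \<open>p\<close> with numbers prime to
  \<open>p\<close>.\<close>

lemma ring_ideal_coprime_multiples:
  fixes m :: "'a :: comm_ring_1 set" and s t :: int
  assumes m: "ring_ideal m" and "coprime s t" "of_int s * u \<in> m" "of_int t * u \<in> m"
  shows "u \<in> m"
proof -
  obtain x y where xy: "x * s + y * t = 1"
    using bezout_int[of s t] assms(2) by (metis coprime_iff_gcd_eq_1)
  have "of_int x * (of_int s * u) + of_int y * (of_int t * u) = of_int (x * s + y * t) * u"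
    by (simp add: algebra_simps)
  also have "\<dots> = u" using xy by simp
  finally show ?thesis using assms by (metis ring_idealD(2,3))
qed

lemma ring_ideal_two_saturation:
  assumes m: "ring_ideal m"
  shows "ring_ideal {u. \<exists>s. 2 ^ s * u \<in> m}"
  unfolding ring_ideal_def
proof (intro conjI ballI allI)
  show "0 \<in> {u. \<exists>s. 2 ^ s * u \<in> m}" using ring_idealD(1)[OF m] by simp
next
  fix u v assume "u \<in> {u. \<exists>s. 2 ^ s * u \<in> m}" "v \<in> {u. \<exists>s. 2 ^ s * u \<in> m}"
  then obtain s t where "2 ^ s * u \<in> m" "2 ^ t * v \<in> m" by auto
  then have "2 ^ t * (2 ^ s * u) + 2 ^ s * (2 ^ t * v) \<in> m" using m by (simp add: ring_idealD)
  then have "2 ^ (s + t) * (u + v) \<in> m" by (simp add: power_add algebra_simps)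
  then show "u + v \<in> {u. \<exists>s. 2 ^ s * u \<in> m}" by blast
next
  fix u r assume "u \<in> {u. \<exists>s. 2 ^ s * u \<in> m}"
  then obtain s where "2 ^ s * u \<in> m" by auto
  then have "2 ^ s * (r * u) \<in> m" using ring_idealD(3)[OF m] by (metis mult.left_commute)
  then show "r * u \<in> {u. \<exists>s. 2 ^ s * u \<in> m}" by blast
qed

lemma poly_taylor2:
  fixes u :: "int poly"
  obtains \<beta> q where "u = of_int (poly u a) + of_int \<beta> * [:- a, 1:] + [:- a, 1:] * [:- a, 1:] * q"
proof -
  have *: "\<exists>q. v = of_int (poly v a) + [:- a, 1:] * q" for v :: "int poly"
  proof -
    have "poly (v - of_int (poly v a)) a = 0" by (simp add: of_int_poly)
    then obtain q where "v - of_int (poly v a) = [:- a, 1:] * q" by (metis poly_eq_0_iff_dvd dvdE)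
    then show ?thesis by (metis diff_add_cancel add.commute)
  qed
  obtain q1 where q1: "u = of_int (poly u a) + [:- a, 1:] * q1" using * by blast
  obtain q2 where q2: "q1 = of_int (poly q1 a) + [:- a, 1:] * q2" using * by blast
  have "u = of_int (poly u a) + [:- a, 1:] * (of_int (poly q1 a) + [:- a, 1:] * q2)"
    using q1 q2 by metis
  also have "\<dots> = of_int (poly u a) + of_int (poly q1 a) * [:- a, 1:] + [:- a, 1:] * [:- a, 1:] * q2"
    by (simp only: distrib_left mult.commute mult.left_commute add.assoc mult.assoc)
  finally show ?thesis by (rule that)
qed

lemma square_mod_square:
  fixes P A B Y Q :: "'a :: idom"
  shows "P\<^sup>2 * A\<^sup>2 + 2 * P * A * B * Y =
    (P * A + B * Y + Y * Y * Q) * (P * A + B * Y + Y * Y * Q)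
    - Y * Y * (B\<^sup>2 + 2 * Q * (P * A + B * Y) + Y * Y * Q * Q)"
  by (simp add: algebra_simps power2_eq_square)

text \<open>Polarization of the isotropy relation: modulo Y^2 and after multiplication by 2 C A, the
  product of two vectors is a combination of their squares. The factor is harmless at an odd prime
  that divides neither A nor C.\<close>

lemma product_mod_square:
  fixes P A B C E Y Q R :: "'a :: idom"
  shows "2 * C * A * ((P * A + B * Y + Y * Y * Q) * (P * C + E * Y + Y * Y * R)) =
    C\<^sup>2 * (P\<^sup>2 * A\<^sup>2 + 2 * P * A * B * Y) + A\<^sup>2 * (P\<^sup>2 * C\<^sup>2 + 2 * P * C * E * Y)
    + Y * Y * (2 * C * A * (B * E + R * (P * A + B * Y) + Q * (P * C + E * Y) + Y * Y * Q * R))"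
  by (simp add: algebra_simps power2_eq_square)

text \<open>Away from 2, an element of another self-annihilating ideal is \<open>\<alpha> + \<beta> y\<close> with \<open>y = x - a\<close> and
  \<open>\<alpha>\<^sup>2 + 2 \<alpha> \<beta> y = 0\<close>. As a hyperbolic plane over \<open>F\<^sub>p\<close> has only two isotropic
  lines, the elements with \<open>\<alpha>\<close> not divisible by \<open>p\<^sup>2\<close> from two such ideals annihilate each other.\<close>

locale cyclic_self_annihilating =
  fixes m I :: "int poly set" and p b a D :: int
  assumes m: "ring_ideal m" and I: "self_annihilating m I"
    and p: "prime p" "odd p" and b: "odd b" "squarefree b" "\<not> p dvd b"
    and D: "D = p\<^sup>2 * b"
    and twoD_in: "of_int (2 * D) \<in> I" and root_in: "2 * [:- a, 1:] \<in> I"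
    and order: "\<And>k. of_int (2 * k) \<in> I \<Longrightarrow> D dvd k"
begin

definition m' :: "int poly set" where "m' = {u. \<exists>s. 2 ^ s * u \<in> m}"

abbreviation y :: "int poly" where "y \<equiv> [:- a, 1:]"

lemma m': "ring_ideal m'"
  unfolding m'_def by (rule ring_ideal_two_saturation[OF m])

lemma m_subset: "m \<subseteq> m'"
proof
  fix u assume "u \<in> m"
  then have "2 ^ 0 * u \<in> m" by simp
  then show "u \<in> m'" unfolding m'_def by blast
qed

lemma in_m'_if_doubles_in:
  assumes "2 * u \<in> I" "2 * v \<in> I"
  shows "u * v \<in> m'"
proof -
  have "2 * u * (2 * v) \<in> m" using assms I self_annihilatingD(2) by blast
  then have "2 ^ 2 * (u * v) \<in> m" by (simp add: algebra_simps)
  then show ?thesis unfolding m'_def by blast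
qed

lemma m_subset_I: "u \<in> m \<Longrightarrow> u \<in> I"
  by (rule self_annihilatingD(3)[OF I]) (rule ring_idealD(4)[OF m])

lemma double_minus_value_in: "2 * u - of_int (2 * poly u a) \<in> I"
proof -
  obtain \<beta> q where "u = of_int (poly u a) + of_int \<beta> * y + y * y * q" by (rule poly_taylor2)
  then have "2 * u = 2 * (of_int (poly u a) + of_int \<beta> * y + y * y * q)" by metis
  then have "2 * u - of_int (2 * poly u a) = 2 * y * (of_int \<beta> + y * q)"
    by (simp add: algebra_simps del: mult_pCons_left mult_pCons_right)
  then show ?thesis using ring_idealD(4)[OF self_annihilatingD(1)[OF I] root_in] by metis
qed

text \<open>After inverting 2, the ideal contains \<open>y\<close> and \<open>D\<close>, so it
  contains the kernel of evaluation at \<open>a\<close> modulo \<open>D\<close>;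
  \<open>order\<close> excludes anything larger.\<close>

lemma double_in_iff: "2 * u \<in> I \<longleftrightarrow> D dvd poly u a"
proof
  note II = self_annihilatingD(1)[OF I]
  assume "2 * u \<in> I"
  then have "2 * u - (2 * u - of_int (2 * poly u a)) \<in> I"
    using ring_idealD(5)[OF II] double_minus_value_in by blast
  then show "D dvd poly u a" using order by simp
next
  note II = self_annihilatingD(1)[OF I]
  assume "D dvd poly u a"
  then obtain k where "poly u a = D * k" by blast
  then have "of_int (2 * poly u a) = of_int (2 * D) * (of_int k :: int poly)" by simp
  then have "of_int (2 * poly u a) \<in> I" using ring_idealD(4)[OF II twoD_in] by metis
  then have "2 * u - of_int (2 * poly u a) + of_int (2 * poly u a) \<in> I"
    using ring_idealD(2)[OF II] double_minus_value_in by blast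
  then show "2 * u \<in> I" by simp
qed

text \<open>Since u^2 lies in \<open>m\<close> and hence in I, \<open>D\<close> divides the square
  of the value at \<open>a\<close>. The squarefree \<open>b\<close> is recovered in full, but only
  one of the two factors \<open>p\<close>: this gap is the whole freedom left to J.\<close>

lemma value_dvd:
  assumes J: "self_annihilating m J" and u: "u \<in> J"
  shows "p dvd poly u a" "b dvd poly u a"
proof -
  have "2 * (u * u) \<in> I"
    using self_annihilatingD(2)[OF J u u] m_subset_I ring_idealD(3)[OF self_annihilatingD(1)[OF I]] by blast
  then have *: "D dvd (poly u a)\<^sup>2" by (simp only: double_in_iff poly_mult power2_eq_square)
  then have "p dvd (poly u a)\<^sup>2" unfolding D by (meson dvd_mult_left dvd_power dvd_trans pos2)
  then show "p dvd poly u a" using p(1) prime_dvd_power by blast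
  have "b dvd (poly u a)\<^sup>2" using * unfolding D by (meson dvd_mult_right)
  then show "b dvd poly u a" using squarefree_dvd_square[OF b(2)] by blast
qed

lemma product_in_m'_aux:
  assumes J: "self_annihilating m J" and K: "self_annihilating m K"
    and u: "u \<in> J" and v: "v \<in> K" and nu: "2 * u \<notin> I" and nv: "2 * v \<notin> I"
  shows "u * v \<in> m'"
proof -
  note ideal = ring_idealD[OF m']
  have cop: "coprime (p\<^sup>2) b" using p(1) b(3) by (simp add: prime_imp_coprime)
  have val: "\<exists>c. poly w a = p * c \<and> \<not> p dvd c"
    if L: "self_annihilating m L" and w: "w \<in> L" and nw: "2 * w \<notin> I" for L w
  proof -
    obtain c where c: "poly w a = p * c" using value_dvd(1)[OF L w] by blast
    have "\<not> p dvd c"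
    proof
      assume "p dvd c"
      then have "p\<^sup>2 dvd poly w a" using c by (simp add: power2_eq_square)
      then have "D dvd poly w a" unfolding D using value_dvd(2)[OF L w] cop
        by (simp add: divides_mult)
      then show False using nw double_in_iff by blast
    qed
    then show ?thesis using c by blast
  qed
  obtain \<alpha> where \<alpha>: "poly u a = p * \<alpha>" "\<not> p dvd \<alpha>" using val[OF J u nu] by blast
  obtain \<gamma> where \<gamma>: "poly v a = p * \<gamma>" "\<not> p dvd \<gamma>" using val[OF K v nv] by blast
  obtain \<beta> q where uq: "u = of_int (p * \<alpha>) + of_int \<beta> * y + y * y * q"
    using poly_taylor2[of u a] \<alpha>(1) by metis
  obtain \<delta> r where vr: "v = of_int (p * \<gamma>) + of_int \<delta> * y + y * y * r"
    using poly_taylor2[of v a] \<gamma>(1) by metis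
  have yy: "y * y \<in> m'" by (rule in_m'_if_doubles_in[OF root_in root_in])
  define F where "F = of_int (p\<^sup>2 * \<alpha>\<^sup>2) + of_int (2 * p * \<alpha> * \<beta>) * y"
  define G where "G = of_int (p\<^sup>2 * \<gamma>\<^sup>2) + of_int (2 * p * \<gamma> * \<delta>) * y"
  have F: "F \<in> m'"
  proof -
    have sq: "u * u \<in> m'" using self_annihilatingD(2)[OF J u u] m_subset by blast
    have eq: "F = u * u - y * y * (of_int (\<beta>\<^sup>2) + 2 * q * (of_int (p * \<alpha>) + of_int \<beta> * y) + y * y * q * q)"
      unfolding F_def uq of_int_mult of_int_power of_int_numeral by (rule square_mod_square)
    show ?thesis unfolding eq by (rule ideal(5)[OF sq ideal(4)[OF yy]])
  qed
  have G: "G \<in> m'"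
  proof -
    have sq: "v * v \<in> m'" using self_annihilatingD(2)[OF K v v] m_subset by blast
    have eq: "G = v * v - y * y * (of_int (\<delta>\<^sup>2) + 2 * r * (of_int (p * \<gamma>) + of_int \<delta> * y) + y * y * r * r)"
      unfolding G_def vr of_int_mult of_int_power of_int_numeral by (rule square_mod_square)
    show ?thesis unfolding eq by (rule ideal(5)[OF sq ideal(4)[OF yy]])
  qed
  have eq: "of_int (2 * \<gamma> * \<alpha>) * (u * v) =
      of_int (\<gamma>\<^sup>2) * F + of_int (\<alpha>\<^sup>2) * G
      + y * y * (of_int (2 * \<gamma> * \<alpha>) * (of_int (\<beta> * \<delta>) + r * (of_int (p * \<alpha>) + of_int \<beta> * y)
          + q * (of_int (p * \<gamma>) + of_int \<delta> * y) + y * y * q * r))"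
    unfolding F_def G_def uq vr of_int_mult of_int_power of_int_numeral by (rule product_mod_square)
  have 1: "of_int (2 * \<gamma> * \<alpha>) * (u * v) \<in> m'"
    unfolding eq by (intro ideal(2) ideal(3)[OF F] ideal(3)[OF G] ideal(4)[OF yy])
  \<comment> \<open>The multiplier 2 \<gamma> \<alpha> in \<open>1\<close> is prime to
    \<open>p\<close> but may contain primes of \<open>b\<close>. Multiplication by p^2 moves both
    factors into I after inverting 2, so p^4 is a second multiplier, coprime to the first.\<close>
  have sq: "2 * (of_int (p\<^sup>2) * w) \<in> I" if "self_annihilating m L" "w \<in> L" for L w
    unfolding double_in_iff D using value_dvd(2)[OF that] by (simp add: of_int_poly)
  have "of_int (p\<^sup>2) * u * (of_int (p\<^sup>2) * v) \<in> m'"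
    by (rule in_m'_if_doubles_in[OF sq[OF J u] sq[OF K v]])
  then have 2: "of_int (p ^ 4) * (u * v) \<in> m'"
    by (simp add: algebra_simps power2_eq_square power4_eq_xxxx)
  have "coprime p 2" using p by (simp add: coprime_right_2_iff_odd)
  then have "coprime (p ^ 4) (2 * \<gamma> * \<alpha>)"
    using \<alpha>(2) \<gamma>(2) p(1) by (simp add: prime_imp_coprime)
  then show ?thesis using ring_ideal_coprime_multiples[OF m' _ 2 1] by blast
qed

text \<open>An element that lies in I after inverting 2 is the difference of two elements of the
  same ideal that do not, obtained by adding \<open>u0\<close> or \<open>v0\<close>. So the previous
  lemma extends by linearity.\<close>

lemma product_in_m':
  assumes J: "self_annihilating m J" and K: "self_annihilating m K"
    and u0: "u0 \<in> J" "2 * u0 \<notin> I" and v0: "v0 \<in> K" "2 * v0 \<notin> I"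
    and u: "u \<in> J" and v: "v \<in> K"
  shows "u * v \<in> m'"
proof -
  note II = ring_idealD[OF self_annihilatingD(1)[OF I]]
  have shift: "2 * (w + w0) \<notin> I" if "2 * w \<in> I" "2 * w0 \<notin> I" for w w0
  proof
    assume "2 * (w + w0) \<in> I"
    then have "2 * (w + w0) - 2 * w \<in> I" using that II(5) by blast
    then show False using that(2) by (simp add: algebra_simps)
  qed
  have left: "w * v \<in> m'" if w: "w \<in> J" "2 * v \<notin> I" for w
  proof (cases "2 * w \<in> I")
    case True
    have "(w + u0) * v \<in> m'" "u0 * v \<in> m'"
      using product_in_m'_aux[OF J K _ v _ w(2)] shift[OF True u0(2)] u0
        ring_idealD(2)[OF self_annihilatingD(1)[OF J] w(1) u0(1)] by simp_all
    then have "(w + u0) * v - u0 * v \<in> m'" using ring_idealD(5)[OF m'] by blast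
    then show ?thesis by (simp add: algebra_simps)
  next
    case False
    then show ?thesis using product_in_m'_aux[OF J K w(1) v _ w(2)] by simp
  qed
  show ?thesis
  proof (cases "2 * v \<in> I")
    case True
    show ?thesis
    proof (cases "2 * u \<in> I")
      case u': True
      show ?thesis by (rule in_m'_if_doubles_in[OF u' True])
    next
      case False
      have "u * (v + v0) \<in> m'" "u * v0 \<in> m'"
        using product_in_m'_aux[OF J K u _ False] shift[OF True v0(2)] v0
          ring_idealD(2)[OF self_annihilatingD(1)[OF K] v v0(1)] by simp_all
      then have "u * (v + v0) - u * v0 \<in> m'" using ring_idealD(5)[OF m'] by blast
      then show ?thesis by (simp add: algebra_simps)
    qed
  next
    case False
    then show ?thesis by (rule left[OF u])
  qed
qed

text \<open>If J or K lies in I after inverting 2, it equals I. Otherwise both contain elements on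
  the second isotropic line, and all products of J and K are in \<open>m'\<close>.\<close>

theorem at_most_two_self_annihilating:
  assumes c: "odd c" "of_int (2 * c) \<in> m"
    and J: "self_annihilating m J" and K: "self_annihilating m K"
  shows "I = J \<or> I = K \<or> J = K"
proof -
  have eqI: "L = L'"
    if L: "self_annihilating m L" "self_annihilating m L'"
      and prod: "\<And>u v. u \<in> L \<Longrightarrow> v \<in> L' \<Longrightarrow> u * v \<in> m'" for L L'
  proof (rule self_annihilating_eqI[OF L])
    fix u v assume uv: "u \<in> L" "v \<in> L'"
    obtain d where d: "odd d" "of_int d * (u * v) \<in> m"
      using self_annihilating_product_at_two[OF m c L uv] by blast
    obtain s where "2 ^ s * (u * v) \<in> m" using prod[OF uv] unfolding m'_def by blast
    then have "of_int (2 ^ s) * (u * v) \<in> m" by simp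
    then show "u * v \<in> m"
      using ring_ideal_coprime_multiples[OF m _ _ d(2), of "2 ^ s"] d(1) by simp
  qed
  have inI: "I = L" if "self_annihilating m L" "\<And>w. w \<in> L \<Longrightarrow> 2 * w \<in> I" for L
    by (intro eqI[OF I that(1)] in_m'_if_doubles_in that(2) ring_idealD(3)[OF self_annihilatingD(1)[OF I]])
  show ?thesis
  proof (cases "(\<forall>w\<in>J. 2 * w \<in> I) \<or> (\<forall>w\<in>K. 2 * w \<in> I)")
    case True then show ?thesis using inI[OF J] inI[OF K] by blast
  next
    case False
    then obtain u0 v0 where "u0 \<in> J" "2 * u0 \<notin> I" "v0 \<in> K" "2 * v0 \<notin> I" by blast
    then have "J = K" by (intro eqI[OF J K] product_in_m'[OF J K])
    then show ?thesis by simp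
  qed
qed

end

subsection \<open>Integral vectors and walk lattices\<close>

text \<open>Vectors are functions on all naturals of which only the arguments below \<open>n\<close>
  are meaningful. This avoids carrier conditions; equalities of vectors are therefore asserted for
  \<open>i < n\<close> only.\<close>

definition mat_op :: "nat \<Rightarrow> (nat \<Rightarrow> nat \<Rightarrow> int) \<Rightarrow> (nat \<Rightarrow> int) \<Rightarrow> nat \<Rightarrow> int" where
  "mat_op n a v = (\<lambda>i. \<Sum>j<n. a i j * v j)"

definition poly_op :: "nat \<Rightarrow> (nat \<Rightarrow> nat \<Rightarrow> int) \<Rightarrow> int poly \<Rightarrow> (nat \<Rightarrow> int) \<Rightarrow> nat \<Rightarrow> int" where
  "poly_op n a p v = (\<lambda>i. \<Sum>k\<le>degree p. coeff p k * (mat_op n a ^^ k) v i)"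

definition inner :: "nat \<Rightarrow> (nat \<Rightarrow> int) \<Rightarrow> (nat \<Rightarrow> int) \<Rightarrow> int" where
  "inner n u v = (\<Sum>i<n. u i * v i)"

abbreviation ones :: "nat \<Rightarrow> int" where "ones \<equiv> \<lambda>_. 1"

lemma mat_op_scale: "mat_op n a (\<lambda>i. c * v i) = (\<lambda>i. c * mat_op n a v i)"
  by (simp add: mat_op_def sum_distrib_left mult.left_commute)

lemma mat_op_sum: "mat_op n a (\<lambda>i. \<Sum>k\<in>A. f k i) = (\<lambda>i. \<Sum>k\<in>A. mat_op n a (f k) i)"
  by (simp add: mat_op_def sum_distrib_left sum.swap[of _ A])

lemma mat_op_cong: "(\<And>j. j < n \<Longrightarrow> u j = v j) \<Longrightarrow> mat_op n a u = mat_op n a v"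
  by (simp add: mat_op_def)

lemma mat_op_funpow_scale:
  "(mat_op n a ^^ k) (\<lambda>i. c * v i) = (\<lambda>i. c * (mat_op n a ^^ k) v i)"
  by (induction k) (simp_all add: mat_op_scale)

lemma mat_op_funpow_sum:
  "(mat_op n a ^^ k) (\<lambda>i. \<Sum>j\<in>A. f j i) = (\<lambda>i. \<Sum>j\<in>A. (mat_op n a ^^ k) (f j) i)"
  by (induction k) (simp_all add: mat_op_sum)

lemma poly_op_eq_sum:
  assumes "degree p \<le> K"
  shows "poly_op n a p v i = (\<Sum>k\<le>K. coeff p k * (mat_op n a ^^ k) v i)"
  unfolding poly_op_def
  by (rule sum.mono_neutral_left) (use assms in \<open>auto simp: coeff_eq_0\<close>)

lemma poly_op_add: "poly_op n a (p + q) v = (\<lambda>i. poly_op n a p v i + poly_op n a q v i)"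
proof
  fix i
  let ?K = "max (degree p) (degree q)"
  show "poly_op n a (p + q) v i = poly_op n a p v i + poly_op n a q v i"
    using degree_add_le_max[of p q]
    by (simp add: poly_op_eq_sum[where K = ?K] distrib_right sum.distrib)
qed

lemma poly_op_smult: "poly_op n a (Polynomial.smult c p) v = (\<lambda>i. c * poly_op n a p v i)"
  by (rule ext) (simp add: poly_op_eq_sum[OF degree_smult_le] poly_op_def sum_distrib_left mult.assoc)

lemma poly_op_0: "poly_op n a 0 v = (\<lambda>i. 0)"
  by (simp add: poly_op_def)

lemma poly_op_pCons: "poly_op n a (pCons c p) v = (\<lambda>i. c * v i + mat_op n a (poly_op n a p v) i)"
proof
  fix i
  have "poly_op n a (pCons c p) v i = (\<Sum>k\<le>Suc (degree p). coeff (pCons c p) k * (mat_op n a ^^ k) v i)"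
    by (rule poly_op_eq_sum) (simp add: degree_pCons_le)
  also have "\<dots> = c * v i + (\<Sum>k\<le>degree p. coeff p k * mat_op n a ((mat_op n a ^^ k) v) i)"
    by (simp add: sum.atMost_Suc_shift del: sum.atMost_Suc)
  also have "\<dots> = c * v i + mat_op n a (poly_op n a p v) i"
    by (simp add: poly_op_def mat_op_sum mat_op_scale)
  finally show "poly_op n a (pCons c p) v i = c * v i + mat_op n a (poly_op n a p v) i" .
qed

lemma mat_op_0: "mat_op n a (\<lambda>i. 0) = (\<lambda>i. 0)"
  by (simp add: mat_op_def)

lemma poly_op_mult: "poly_op n a (p * q) v = poly_op n a p (poly_op n a q v)"
  by (induction p) (simp_all add: poly_op_0 poly_op_add poly_op_smult poly_op_pCons)

lemma poly_op_of_int: "poly_op n a (of_int c) v = (\<lambda>i. c * v i)"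
  by (simp add: of_int_poly poly_op_pCons poly_op_0 mat_op_0)

lemma poly_op_1: "poly_op n a 1 v = v"
  using poly_op_of_int[of n a 1 v] by simp

lemma poly_op_monom: "poly_op n a (monom 1 k) v = (mat_op n a ^^ k) v"
  by (induction k) (simp_all add: poly_op_1 monom_Suc poly_op_pCons)

lemma poly_op_scale: "poly_op n a p (\<lambda>i. c * v i) = (\<lambda>i. c * poly_op n a p v i)"
  by (simp add: poly_op_def mat_op_funpow_scale sum_distrib_left mult.left_commute)

lemma poly_op_cong:
  assumes "\<And>j. j < n \<Longrightarrow> u j = v j" "i < n"
  shows "poly_op n a p u i = poly_op n a p v i"
  using assms(2)
proof (induction p arbitrary: i)
  case (pCons c p)
  then have "mat_op n a (poly_op n a p u) = mat_op n a (poly_op n a p v)" by (intro mat_op_cong)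
  then show ?case using assms(1) pCons by (simp add: poly_op_pCons)
qed (simp add: poly_op_0)

lemma poly_op_dvd:
  assumes "\<And>j. j < n \<Longrightarrow> N dvd v j" "i < n"
  shows "N dvd poly_op n a p v i"
  using assms(2)
proof (induction p arbitrary: i)
  case (pCons c p)
  then have "N dvd mat_op n a (poly_op n a p v) i" by (auto simp: mat_op_def intro!: dvd_sum)
  then show ?case using assms(1) pCons by (simp add: poly_op_pCons)
qed (simp add: poly_op_0)

lemma inner_commute: "inner n u v = inner n v u"
  by (simp add: inner_def mult.commute)

lemma inner_cong:
  "(\<And>i. i < n \<Longrightarrow> u i = u' i) \<Longrightarrow> (\<And>i. i < n \<Longrightarrow> v i = v' i) \<Longrightarrow> inner n u v = inner n u' v'"
  by (simp add: inner_def)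

lemma inner_add_right: "inner n u (\<lambda>i. v i + w i) = inner n u v + inner n u w"
  by (simp add: inner_def distrib_left sum.distrib)

lemma inner_diff_right: "inner n u (\<lambda>i. v i - w i) = inner n u v - inner n u w"
  by (simp add: inner_def right_diff_distrib sum_subtractf)

lemma inner_scale_right: "inner n u (\<lambda>i. c * v i) = c * inner n u v"
  by (simp add: inner_def sum_distrib_left mult.left_commute)

lemma inner_scale_left: "inner n (\<lambda>i. c * u i) v = c * inner n u v"
  by (simp add: inner_def sum_distrib_left mult.assoc)

lemma inner_sum_right: "inner n u (\<lambda>i. \<Sum>k\<in>A. f k i) = (\<Sum>k\<in>A. inner n u (f k))"
  by (simp add: inner_def sum_distrib_left sum.swap[of _ A])

lemma inner_dvd_mult:
  assumes "\<And>i. i < n \<Longrightarrow> N dvd u i" "\<And>i. i < n \<Longrightarrow> M dvd v i"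
  shows "N * M dvd inner n u v"
  unfolding inner_def by (rule dvd_sum) (use assms in \<open>auto intro: mult_dvd_mono\<close>)

locale sym_op =
  fixes n :: nat and a :: "nat \<Rightarrow> nat \<Rightarrow> int"
  assumes sym: "\<And>i j. i < n \<Longrightarrow> j < n \<Longrightarrow> a i j = a j i"
begin

lemma inner_mat_op: "inner n (mat_op n a u) v = inner n u (mat_op n a v)"
proof -
  have "inner n (mat_op n a u) v = (\<Sum>i<n. \<Sum>j<n. a i j * u j * v i)"
    by (simp add: inner_def mat_op_def sum_distrib_right)
  also have "\<dots> = (\<Sum>j<n. \<Sum>i<n. a i j * u j * v i)" by (rule sum.swap)
  also have "\<dots> = (\<Sum>j<n. \<Sum>i<n. u j * (a j i * v i))"
    by (intro sum.cong refl) (simp add: sym mult.commute mult.left_commute)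
  finally show ?thesis by (simp add: inner_def mat_op_def sum_distrib_left)
qed

lemma inner_poly_op: "inner n (poly_op n a p u) v = inner n u (poly_op n a p v)"
proof (induction p arbitrary: v)
  case (pCons c p)
  have "inner n (poly_op n a (pCons c p) u) v = c * inner n u v + inner n (mat_op n a (poly_op n a p u)) v"
    by (simp add: poly_op_pCons inner_commute[of _ _ v] inner_add_right inner_scale_right)
  also have "inner n (mat_op n a (poly_op n a p u)) v = inner n u (poly_op n a p (mat_op n a v))"
    by (simp add: inner_mat_op pCons)
  also have "poly_op n a p (mat_op n a v) = poly_op n a (p * monom 1 1) v"
    by (simp add: poly_op_mult poly_op_monom)
  also have "\<dots> = mat_op n a (poly_op n a p v)"
    by (simp add: mult.commute[of p] poly_op_mult poly_op_monom)
  finally show ?case by (simp add: poly_op_pCons inner_add_right inner_scale_right)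
qed (simp add: poly_op_0 inner_def)

lemma inner_funpow: "inner n ((mat_op n a ^^ k) u) v = inner n u ((mat_op n a ^^ k) v)"
  using inner_poly_op[of "monom 1 k" u v] by (simp add: poly_op_monom)

lemma inner_funpow_shift:
  "inner n ((mat_op n a ^^ j) u) ((mat_op n a ^^ k) v) = inner n ((mat_op n a ^^ (j + k)) u) v"
proof -
  have "(mat_op n a ^^ (j + k)) u = (mat_op n a ^^ k) ((mat_op n a ^^ j) u)"
    by (simp add: add.commute[of j] funpow_add)
  then show ?thesis by (simp add: inner_funpow)
qed

end

text \<open>The moment functional of A at e. Every pairing of two vectors p(A) e and q(A) e is one
  of its values, and it is what generalized cospectral graphs share.\<close>

definition walk_functional :: "nat \<Rightarrow> (nat \<Rightarrow> nat \<Rightarrow> int) \<Rightarrow> int poly \<Rightarrow> int" where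
  "walk_functional n a p = inner n ones (poly_op n a p ones)"

text \<open>The vector \<open>r(A) e / N\<close> is the last column of the inverse transposed walk matrix.
  It generates the dual of the walk lattice as a module over the integer polynomials, so the
  lattices between the walk lattice and its dual correspond to ideals.\<close>

locale walk_op = sym_op +
  fixes r :: "int poly" and N :: int
  assumes N_nonzero: "N \<noteq> 0"
    and nonsingular: "\<And>y i. (\<And>k. k < n \<Longrightarrow> inner n ((mat_op n a ^^ k) ones) y = 0) \<Longrightarrow> i < n \<Longrightarrow> y i = 0"
    and recurrence: "\<exists>c. \<forall>i<n. (mat_op n a ^^ n) ones i = (\<Sum>k<n. c k * (mat_op n a ^^ k) ones i)"
    and generator: "\<And>k. k < n \<Longrightarrow> walk_functional n a (monom 1 k * r) = (if k = n - 1 then N else 0)"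
begin

text \<open>For k \<ge> n, the excess power of A is shifted onto y and \<open>recurrence\<close> is
  applied to A^n e, which leads back to smaller exponents.\<close>

lemma inner_walk_dvd:
  assumes "\<And>k. k < n \<Longrightarrow> M dvd inner n ((mat_op n a ^^ k) ones) y"
  shows "M dvd inner n ((mat_op n a ^^ k) ones) y"
proof (induction k rule: less_induct)
  case (less k)
  show ?case
  proof (cases "k < n")
    case False
    obtain c where c: "\<And>i. i < n \<Longrightarrow> (mat_op n a ^^ n) ones i = (\<Sum>k<n. c k * (mat_op n a ^^ k) ones i)"
      using recurrence by blast
    have pow: "inner n ((mat_op n a ^^ j) ones) ((mat_op n a ^^ (k - n)) y)
        = inner n ((mat_op n a ^^ (j + (k - n))) ones) y" for j
      by (rule inner_funpow_shift)
    have "inner n ((mat_op n a ^^ k) ones) y = inner n ((mat_op n a ^^ n) ones) ((mat_op n a ^^ (k - n)) y)"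
      using pow[of n] False by simp
    also have "\<dots> = inner n (\<lambda>i. \<Sum>j<n. c j * (mat_op n a ^^ j) ones i) ((mat_op n a ^^ (k - n)) y)"
      by (rule inner_cong) (simp_all add: c)
    also have "\<dots> = (\<Sum>j<n. c j * inner n ((mat_op n a ^^ (j + (k - n))) ones) y)"
      by (simp add: inner_commute[of _ _ "(mat_op n a ^^ (k - n)) y"] inner_sum_right inner_scale_right)
        (simp add: inner_commute[of _ "(mat_op n a ^^ (k - n)) y"] pow)
    finally show ?thesis using less False by (auto intro!: dvd_sum)
  qed (use assms in blast)
qed

definition z :: "nat \<Rightarrow> int" where "z = poly_op n a r ones"

definition lattice_ideal :: "int poly set" where
  "lattice_ideal = {u. \<forall>i<n. N dvd poly_op n a u z i}"

lemma inner_walk_z: "inner n ones (poly_op n a u z) = walk_functional n a (u * r)"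
  by (simp add: z_def poly_op_mult walk_functional_def)

lemma inner_z_z: "inner n (poly_op n a u z) (poly_op n a v z) = walk_functional n a (r * u * v * r)"
proof -
  have "inner n (poly_op n a u z) (poly_op n a v z)
      = inner n (poly_op n a r ones) (poly_op n a u (poly_op n a v (poly_op n a r ones)))"
    by (simp add: z_def inner_poly_op)
  also have "\<dots> = walk_functional n a (r * u * v * r)"
    by (simp add: inner_poly_op walk_functional_def poly_op_mult mult.assoc)
  finally show ?thesis .
qed

text \<open>These are the w with w(A) f in M: as M is the dual of the module generated by f, the
  condition is that w(A) f pairs integrally with every s(A) f. Only the functional, \<open>r\<close>
  and \<open>N\<close> occur, so cospectral graphs share this ideal.\<close>

definition dual_ideal :: "int poly set" where
  "dual_ideal = {w. \<forall>s. N\<^sup>2 dvd walk_functional n a (r * (w * s) * r)}"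

lemma ring_ideal_lattice_ideal: "ring_ideal lattice_ideal"
  unfolding ring_ideal_def lattice_ideal_def
  by (auto simp: poly_op_0 poly_op_add poly_op_mult intro: poly_op_dvd)

lemma walk_functional_add:
  "walk_functional n a (p + q) = walk_functional n a p + walk_functional n a q"
  by (simp add: walk_functional_def poly_op_add inner_add_right)

lemma ring_ideal_dual_ideal: "ring_ideal dual_ideal"
  unfolding ring_ideal_def dual_ideal_def
proof (intro conjI ballI allI)
  show "0 \<in> {w. \<forall>s. N\<^sup>2 dvd walk_functional n a (r * (w * s) * r)}"
    by (simp add: walk_functional_def poly_op_0 inner_def)
next
  fix u v assume "u \<in> {w. \<forall>s. N\<^sup>2 dvd walk_functional n a (r * (w * s) * r)}"
    "v \<in> {w. \<forall>s. N\<^sup>2 dvd walk_functional n a (r * (w * s) * r)}"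
  then show "u + v \<in> {w. \<forall>s. N\<^sup>2 dvd walk_functional n a (r * (w * s) * r)}"
    by (simp add: distrib_left distrib_right walk_functional_add)
next
  fix u t assume u: "u \<in> {w. \<forall>s. N\<^sup>2 dvd walk_functional n a (r * (w * s) * r)}"
  then have "N\<^sup>2 dvd walk_functional n a (r * (u * (t * s)) * r)" for s by simp
  then show "t * u \<in> {w. \<forall>s. N\<^sup>2 dvd walk_functional n a (r * (w * s) * r)}"
    by (simp add: mult.assoc mult.left_commute)
qed

lemma inner_funpow_z:
  assumes "k + j < n"
  shows "inner n ((mat_op n a ^^ k) ones) ((mat_op n a ^^ j) z) = (if k + j = n - 1 then N else 0)"
proof -
  have "inner n ((mat_op n a ^^ k) ones) ((mat_op n a ^^ j) z)
      = inner n ones (poly_op n a (monom 1 k * monom 1 j) z)"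
    by (simp add: inner_funpow poly_op_mult poly_op_monom)
  also have "\<dots> = walk_functional n a (monom 1 (k + j) * r)"
    by (simp add: inner_walk_z mult_monom)
  finally show ?thesis using generator[OF assms] by simp
qed

lemma inner_poly_op_z_dvd: "N dvd inner n ((mat_op n a ^^ k) ones) (poly_op n a v z)"
proof -
  have "N dvd inner n ((mat_op n a ^^ k) ones) ((mat_op n a ^^ j) z)" for k j
  proof -
    have "inner n ((mat_op n a ^^ k) ones) ((mat_op n a ^^ j) z) = inner n ((mat_op n a ^^ (k + j)) ones) z"
      by (rule inner_funpow_shift)
    moreover have "N dvd inner n ((mat_op n a ^^ k) ones) z" if "k < n" for k
      using inner_funpow_z[of k 0] that by simp
    ultimately show ?thesis using inner_walk_dvd by metis
  qed
  then show ?thesis by (auto simp: poly_op_def inner_sum_right inner_scale_right intro!: dvd_sum)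
qed

text \<open>The pairings of A^k e with A^j z are \<open>N\<close> for k + j = n - 1 and 0 for
  smaller k + j, a triangular system. Adding a multiple of A^(n-1-m) z corrects the value at m and
  preserves those at k < m. Hence f generates the whole dual of M.\<close>

lemma poly_op_z_interpolates:
  "\<exists>v. \<forall>k<n. inner n ((mat_op n a ^^ k) ones) (poly_op n a v z) = N * t k"
proof -
  have "m \<le> n \<Longrightarrow> \<exists>v. \<forall>k<m. inner n ((mat_op n a ^^ k) ones) (poly_op n a v z) = N * t k" for m
  proof (induction m)
    case (Suc m)
    then obtain v where v: "\<And>k. k < m \<Longrightarrow> inner n ((mat_op n a ^^ k) ones) (poly_op n a v z) = N * t k"
      by auto
    have m: "m < n" using Suc by simp
    have "N dvd inner n ((mat_op n a ^^ m) ones) (poly_op n a v z)" by (rule inner_poly_op_z_dvd)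
    then obtain s where s: "inner n ((mat_op n a ^^ m) ones) (poly_op n a v z) = N * s" by blast
    let ?v = "v + Polynomial.smult (t m - s) (monom 1 (n - 1 - m))"
    have eq: "inner n ((mat_op n a ^^ k) ones) (poly_op n a ?v z)
      = inner n ((mat_op n a ^^ k) ones) (poly_op n a v z)
        + (t m - s) * inner n ((mat_op n a ^^ k) ones) ((mat_op n a ^^ (n - 1 - m)) z)" for k
      by (simp only: poly_op_add poly_op_smult poly_op_monom inner_add_right inner_scale_right)
    have "inner n ((mat_op n a ^^ k) ones) (poly_op n a ?v z) = N * t k" if "k < Suc m" for k
    proof (cases "k = m")
      case True
      then show ?thesis unfolding eq using m s by (simp add: inner_funpow_z algebra_simps)
    next
      case False
      then have "k + (n - 1 - m) < n - 1" using that m by linarith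
      then show ?thesis unfolding eq using v[of k] that False by (simp add: inner_funpow_z)
    qed
    then show ?case by blast
  qed simp
  then show ?thesis by blast
qed

lemma poly_op_z_represents:
  obtains v where "\<And>i. i < n \<Longrightarrow> poly_op n a v z i = N * w i"
proof -
  obtain v where v: "\<And>k. k < n \<Longrightarrow>
      inner n ((mat_op n a ^^ k) ones) (poly_op n a v z) = N * inner n ((mat_op n a ^^ k) ones) w"
    using poly_op_z_interpolates[of "\<lambda>k. inner n ((mat_op n a ^^ k) ones) w"] by blast
  have "poly_op n a v z i - N * w i = 0" if "i < n" for i
    by (rule nonsingular[OF _ that]) (simp add: inner_diff_right inner_scale_right v)
  then show ?thesis by (intro that[of v]) simp
qed

lemma self_annihilating_lattice_ideal: "self_annihilating dual_ideal lattice_ideal"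
  unfolding self_annihilating_def
proof (intro conjI allI iffI ballI)
  show "ring_ideal lattice_ideal" by (rule ring_ideal_lattice_ideal)
next
  fix u v assume u: "u \<in> lattice_ideal" and v: "v \<in> lattice_ideal"
  have "N\<^sup>2 dvd walk_functional n a (r * (u * v * s) * r)" for s
  proof -
    have "s * v \<in> lattice_ideal" using v ring_idealD(3)[OF ring_ideal_lattice_ideal] by blast
    then have "N * N dvd inner n (poly_op n a u z) (poly_op n a (s * v) z)"
      using u by (intro inner_dvd_mult) (auto simp: lattice_ideal_def)
    then show ?thesis by (simp add: inner_z_z power2_eq_square ac_simps)
  qed
  then show "u * v \<in> dual_ideal" by (simp add: dual_ideal_def)
next
  fix u assume u: "\<forall>v\<in>lattice_ideal. u * v \<in> dual_ideal"
  have "N dvd poly_op n a u z i" if i: "i < n" for i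
  proof -
    \<comment> \<open>Pairing with \<open>N\<close> times the i-th unit vector reads off coordinate
      i; this is unimodularity of the integral lattice.\<close>
    obtain v where v: "\<And>j. j < n \<Longrightarrow> poly_op n a v z j = N * (if j = i then 1 else 0)"
      using poly_op_z_represents[where w = "\<lambda>j. if j = i then 1 else 0"] by blast
    then have "v \<in> lattice_ideal" by (simp add: lattice_ideal_def)
    then have "\<forall>s. N\<^sup>2 dvd walk_functional n a (r * (u * v * s) * r)"
      using u by (simp add: dual_ideal_def)
    from this[rule_format, of 1] have "N * N dvd inner n (poly_op n a u z) (poly_op n a v z)"
      by (simp add: inner_z_z power2_eq_square mult.assoc)
    also have "inner n (poly_op n a u z) (poly_op n a v z)
        = inner n (poly_op n a u z) (\<lambda>j. N * (if j = i then 1 else 0))"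
      by (rule inner_cong) (simp_all add: v)
    also have "\<dots> = N * poly_op n a u z i"
      using i by (simp add: inner_scale_right) (simp add: inner_def if_distrib cong: if_cong)
    finally show ?thesis using N_nonzero by simp
  qed
  then show "u \<in> lattice_ideal" by (simp add: lattice_ideal_def)
qed

end

section \<open>Recovering a graph from its ideal\<close>

lemma int_unit_vector:
  fixes x :: "nat \<Rightarrow> int"
  assumes sq: "(\<Sum>k<n. x k * x k) = 1" and sum: "(\<Sum>k<n. x k) = 1"
  obtains l where "l < n" "\<And>k. k < n \<Longrightarrow> x k = (if k = l then 1 else 0)"
proof -
  have "(\<Sum>k<n. x k * x k) \<noteq> 0" using sq by simp
  then obtain l where l: "l < n" "x l * x l \<noteq> 0" by (meson lessThan_iff sum.neutral)
  have split: "(\<Sum>k<n. f k) = f l + (\<Sum>k\<in>{..<n} - {l}. f k)" for f :: "nat \<Rightarrow> int"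
    using l by (simp add: sum.remove)
  have "x l * x l \<ge> 1" using l(2) by (metis int_one_le_iff_zero_less less_le zero_le_square)
  moreover have nonneg: "(\<Sum>k\<in>{..<n} - {l}. x k * x k) \<ge> 0" by (simp add: sum_nonneg)
  ultimately have "(\<Sum>k\<in>{..<n} - {l}. x k * x k) = 0" using split[of "\<lambda>k. x k * x k"] sq by linarith
  then have zero: "\<forall>k\<in>{..<n} - {l}. x k = 0" by (subst (asm) sum_nonneg_eq_0_iff) auto
  then have "x l = 1" using split[of x] sum by simp
  then show ?thesis using that[of l] l zero by auto
qed

text \<open>The rows of \<open>P\<close> are the images of the unit vectors under u(A) f -> u(A')
  f'. The inclusion makes them integral; equal functionals preserve inner products and the pairing
  with e, so they are distinct unit vectors. The entries of A are the pairings of e_i with A e_j and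
  are preserved for the same reason.\<close>

lemma lattice_ideal_subset_imp_permutation:
  fixes a a' :: "nat \<Rightarrow> nat \<Rightarrow> int"
  assumes A: "walk_op n a r N" and A': "walk_op n a' r N"
    and walk: "\<And>p. walk_functional n a p = walk_functional n a' p"
    and sub: "walk_op.lattice_ideal n a r N \<subseteq> walk_op.lattice_ideal n a' r N"
  obtains \<sigma> where "bij_betw \<sigma> {..<n} {..<n}" "\<And>i j. i < n \<Longrightarrow> j < n \<Longrightarrow> a i j = a' (\<sigma> i) (\<sigma> j)"
proof -
  interpret A: walk_op n a r N by (rule A)
  interpret A': walk_op n a' r N by (rule A')
  let ?\<delta> = "\<lambda>i j :: nat. if j = i then 1 else 0 :: int"
  have "\<exists>v. \<forall>j<n. poly_op n a v A.z j = N * ?\<delta> i j" for i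
    using A.poly_op_z_represents[of "?\<delta> i"] by blast
  then obtain v where v: "\<And>i j. j < n \<Longrightarrow> poly_op n a (v i) A.z j = N * ?\<delta> i j" by metis
  then have "v i \<in> A'.lattice_ideal" for i using sub by (auto simp: A.lattice_ideal_def)
  then have "\<exists>x. \<forall>j<n. poly_op n a' (v i) A'.z j = N * x j" for i
    unfolding A'.lattice_ideal_def dvd_def by (simp add: choice_iff')
  then obtain P where P: "\<And>i j. j < n \<Longrightarrow> poly_op n a' (v i) A'.z j = N * P i j" by metis
  have NN: "N * N \<noteq> 0" using A.N_nonzero by simp
  have \<delta>: "inner n (?\<delta> i) w = w i" if "i < n" for i w
    using that by (simp add: inner_def if_distrib[of "\<lambda>x. x * _"] cong: if_cong)
  have orth: "inner n (P i) (P j) = ?\<delta> i j" if "i < n" "j < n" for i j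
  proof -
    have "N * N * inner n (P i) (P j) = inner n (poly_op n a' (v i) A'.z) (poly_op n a' (v j) A'.z)"
      by (simp add: P inner_scale_left inner_scale_right cong: inner_cong)
    also have "\<dots> = inner n (poly_op n a (v i) A.z) (poly_op n a (v j) A.z)"
      by (simp add: A.inner_z_z A'.inner_z_z walk)
    also have "\<dots> = inner n (\<lambda>k. N * ?\<delta> i k) (\<lambda>k. N * ?\<delta> j k)"
      by (rule inner_cong) (simp_all add: v)
    also have "\<dots> = N * N * ?\<delta> i j"
      using that by (simp only: inner_scale_left inner_scale_right \<delta>) simp
    finally show ?thesis using NN by simp
  qed
  have total: "inner n ones (P i) = 1" if "i < n" for i
  proof -
    have "N * inner n ones (P i) = inner n ones (poly_op n a' (v i) A'.z)"
      by (simp add: P inner_scale_right cong: inner_cong)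
    also have "\<dots> = inner n ones (poly_op n a (v i) A.z)"
      by (simp add: A.inner_walk_z A'.inner_walk_z walk)
    also have "\<dots> = inner n ones (\<lambda>k. N * ?\<delta> i k)" by (rule inner_cong) (simp_all add: v)
    also have "\<dots> = N" using that by (simp only: inner_scale_right) (simp add: inner_def)
    finally show ?thesis using A.N_nonzero by simp
  qed
  have "\<exists>l. l < n \<and> (\<forall>k<n. P i k = ?\<delta> l k)" if "i < n" for i
    using int_unit_vector[of "P i" n] orth[OF that that] total[OF that] by (simp add: inner_def) metis
  then obtain \<sigma> where \<sigma>: "\<And>i. i < n \<Longrightarrow> \<sigma> i < n" "\<And>i k. i < n \<Longrightarrow> k < n \<Longrightarrow> P i k = ?\<delta> (\<sigma> i) k"
    by metis
  have "inj_on \<sigma> {..<n}"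
  proof (rule inj_onI)
    fix i j assume ij: "i \<in> {..<n}" "j \<in> {..<n}" "\<sigma> i = \<sigma> j"
    then have "inner n (P i) (P j) = inner n (?\<delta> (\<sigma> i)) (?\<delta> (\<sigma> i))"
      by (intro inner_cong) (simp_all add: \<sigma>)
    also have "\<dots> = 1" using ij \<sigma>(1) by (simp only: \<delta> lessThan_iff) simp
    finally show "i = j" using orth[of i j] ij by (simp split: if_splits)
  qed
  then have bij: "bij_betw \<sigma> {..<n} {..<n}"
    using \<sigma>(1) endo_inj_surj[of "{..<n}" \<sigma>] by (auto simp: bij_betw_def)
  have entry: "a i j = a' (\<sigma> i) (\<sigma> j)" if ij: "i < n" "j < n" for i j
  proof -
    have x: "mat_op n b w = poly_op n b (monom 1 1) w" for b w by (simp add: poly_op_monom)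
    have m: "mat_op n b (\<lambda>k. N * ?\<delta> l k) = (\<lambda>k. N * b k l)" if "l < n" for b l
      using that by (simp add: mat_op_scale) (simp add: mat_op_def if_distrib cong: if_cong)
    have P\<sigma>: "poly_op n a' (v l) A'.z k = N * ?\<delta> (\<sigma> l) k" if "l < n" "k < n" for l k
      using P[OF that(2)] \<sigma>(2)[OF that] by simp
    have m1: "mat_op n a (poly_op n a (v j) A.z) = mat_op n a (\<lambda>k. N * ?\<delta> j k)"
      by (rule mat_op_cong) (rule v)
    have m2: "mat_op n a' (poly_op n a' (v j) A'.z) = mat_op n a' (\<lambda>k. N * ?\<delta> (\<sigma> j) k)"
      by (rule mat_op_cong) (rule P\<sigma>[OF ij(2)])
    have "N * N * a i j = inner n (\<lambda>k. N * ?\<delta> i k) (mat_op n a (\<lambda>k. N * ?\<delta> j k))"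
      using ij by (simp only: m inner_scale_left \<delta>; simp)
    also have "\<dots> = inner n (poly_op n a (v i) A.z) (mat_op n a (poly_op n a (v j) A.z))"
      by (rule inner_cong) (simp_all only: v m1)
    also have "\<dots> = inner n (poly_op n a' (v i) A'.z) (mat_op n a' (poly_op n a' (v j) A'.z))"
      by (simp only: x poly_op_mult[symmetric] A.inner_z_z A'.inner_z_z walk)
    also have "\<dots> = inner n (\<lambda>k. N * ?\<delta> (\<sigma> i) k) (mat_op n a' (\<lambda>k. N * ?\<delta> (\<sigma> j) k))"
      by (rule inner_cong) (simp_all only: P\<sigma>[OF ij(1)] m2)
    also have "\<dots> = N * N * a' (\<sigma> i) (\<sigma> j)"
      using ij \<sigma>(1) by (simp only: m inner_scale_left \<delta>; simp)
    finally show ?thesis using NN by simp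
  qed
  show ?thesis by (rule that[OF bij entry])
qed

section \<open>What the Smith normal form says about the ideals\<close>

lemma even_symmetric_double_sum:
  fixes f :: "nat \<Rightarrow> nat \<Rightarrow> int"
  assumes "\<And>i j. i < n \<Longrightarrow> j < n \<Longrightarrow> f i j = f j i" "\<And>i. i < n \<Longrightarrow> even (f i i)"
  shows "even (\<Sum>i<n. \<Sum>j<n. f i j)"
  using assms
proof (induction n)
  case (Suc n)
  have "(\<Sum>i<n. f i n) = (\<Sum>j<n. f n j)" using Suc.prems(1) by (intro sum.cong) auto
  then have "(\<Sum>i<Suc n. \<Sum>j<Suc n. f i j) = (\<Sum>i<n. \<Sum>j<n. f i j) + 2 * (\<Sum>j<n. f n j) + f n n"
    by (simp add: sum.distrib)
  then show ?case using Suc by simp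
qed simp

text \<open>The vector \<open>z0\<close> is \<open>2D\<close> times the generator of the dual of the walk lattice;
  \<open>g\<close> spans the image modulo \<open>D\<close> of the vectors in \<open>2D\<close> times that dual.\<close>

locale smith_walk_op = walk_op +
  fixes D :: int and z0 g h :: "nat \<Rightarrow> int"
  assumes diag: "\<And>i. i < n \<Longrightarrow> a i i = 0"
    and D_odd: "odd D"
    and z0: "\<And>k. k < n \<Longrightarrow> inner n ((mat_op n a ^^ k) ones) z0 = (if k = n - 1 then 2 * D else 0)"
    and g_dvd: "\<And>k. k < n \<Longrightarrow> 2 * D dvd inner n ((mat_op n a ^^ k) ones) g"
    and primitive: "inner n g h = 1"
    and cyclic: "\<And>y. (\<And>k. k < n \<Longrightarrow> 2 * D dvd inner n ((mat_op n a ^^ k) ones) y)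
      \<Longrightarrow> \<exists>c. \<forall>i<n. D dvd y i - c * g i"
begin

lemma D_nonzero: "D \<noteq> 0"
  using D_odd by auto

text \<open>Both sides pair equally with all A^k e. Thus f is also \<open>z0\<close> / (2 D), which
  replaces the denominator \<open>N\<close> by 2 D.\<close>

lemma z_z0: "i < n \<Longrightarrow> 2 * D * z i = N * z0 i"
proof -
  assume i: "i < n"
  have "2 * D * z i - N * z0 i = 0"
  proof (rule nonsingular[OF _ i])
    fix k assume k: "k < n"
    show "inner n ((mat_op n a ^^ k) ones) (\<lambda>i. 2 * D * z i - N * z0 i) = 0"
      using inner_funpow_z[of k 0] k z0[OF k] by (simp add: inner_diff_right inner_scale_right)
  qed
  then show ?thesis by simp
qed

lemma poly_op_z_z0: "i < n \<Longrightarrow> 2 * D * poly_op n a u z i = N * poly_op n a u z0 i"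
  using poly_op_cong[of n "\<lambda>i. 2 * D * z i" "\<lambda>i. N * z0 i" i a u] z_z0
  by (simp only: poly_op_scale)

lemma lattice_ideal_z0: "u \<in> lattice_ideal \<longleftrightarrow> (\<forall>i<n. 2 * D dvd poly_op n a u z0 i)"
proof -
  have "N dvd poly_op n a u z i \<longleftrightarrow> 2 * D dvd poly_op n a u z0 i" if "i < n" for i
  proof -
    have "N dvd poly_op n a u z i \<longleftrightarrow> 2 * D * N dvd 2 * D * poly_op n a u z i"
      using D_nonzero by simp
    also have "\<dots> \<longleftrightarrow> N * (2 * D) dvd N * poly_op n a u z0 i"
      using poly_op_z_z0[OF that] by (simp only: mult.commute[of "2 * D" N])
    also have "\<dots> \<longleftrightarrow> 2 * D dvd poly_op n a u z0 i" using N_nonzero by (simp only: dvd_mult_cancel_left) simp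
    finally show ?thesis .
  qed
  then show ?thesis by (simp add: lattice_ideal_def)
qed

lemma twoD_in_lattice_ideal: "of_int (2 * D) \<in> lattice_ideal"
  unfolding lattice_ideal_z0 poly_op_of_int by simp

text \<open>The integral vectors in 2 D times the dual are stable under A and multiples of
  \<open>g\<close> modulo \<open>D\<close>, so \<open>g\<close> is an eigenvector modulo
  \<open>D\<close> with eigenvalue \<open>l\<close>. As \<open>z0\<close> is such a multiple, 2 (A -
  l) kills it modulo 2 D.\<close>

lemma root_in_lattice_ideal: "\<exists>l. 2 * [:- l, 1:] \<in> lattice_ideal"
proof -
  have "2 * D dvd inner n ((mat_op n a ^^ k) ones) (mat_op n a g)" for k
    using inner_walk_dvd[OF g_dvd, of "k + 1"] inner_funpow_shift[of k ones 1 g] by simp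
  then obtain l where l: "\<And>i. i < n \<Longrightarrow> D dvd mat_op n a g i - l * g i" using cyclic by blast
  have "2 * D dvd inner n ((mat_op n a ^^ k) ones) z0" if "k < n" for k using z0[OF that] by simp
  then obtain c where c: "\<And>i. i < n \<Longrightarrow> D dvd z0 i - c * g i" using cyclic[of z0] by blast
  have dvd: "D dvd mat_op n a z0 i - l * z0 i" if i: "i < n" for i
  proof -
    have "D dvd mat_op n a (\<lambda>i. z0 i - c * g i) i"
      using c by (auto simp: mat_op_def intro!: dvd_sum)
    moreover have "mat_op n a (\<lambda>i. z0 i - c * g i) i = mat_op n a z0 i - c * mat_op n a g i"
      by (simp add: mat_op_def sum_subtractf sum_distrib_left algebra_simps)
    moreover have "D dvd c * (mat_op n a g i - l * g i)" "D dvd l * (z0 i - c * g i)"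
      using c l i by auto
    ultimately have "D dvd (mat_op n a z0 i - c * mat_op n a g i) + c * (mat_op n a g i - l * g i)
        - l * (z0 i - c * g i)" by (metis dvd_add dvd_diff)
    then show ?thesis by (simp add: algebra_simps)
  qed
  have eq: "poly_op n a (2 * [:- l, 1:]) z0 = (\<lambda>i. 2 * (mat_op n a z0 i - l * z0 i))"
    by (simp add: numeral_poly poly_op_pCons poly_op_0 mat_op_0 mat_op_scale) (simp add: algebra_simps)
  have "2 * [:- l, 1:] \<in> lattice_ideal"
    unfolding lattice_ideal_z0 eq by (intro allI impI mult_dvd_mono dvd_refl dvd)
  then show ?thesis by blast
qed

text \<open>Since f generates the dual, \<open>g\<close> is v(A) z0 for some \<open>v\<close>. So
  \<open>D\<close> divides all k g_i, and pairing with \<open>h\<close> leaves k.\<close>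

lemma order_in_lattice_ideal:
  assumes "of_int (2 * k) \<in> lattice_ideal"
  shows "D dvd k"
proof -
  obtain t where t: "\<And>k. k < n \<Longrightarrow> inner n ((mat_op n a ^^ k) ones) g = 2 * D * t k"
    using g_dvd unfolding dvd_def by metis
  obtain v where v: "\<And>k. k < n \<Longrightarrow> inner n ((mat_op n a ^^ k) ones) (poly_op n a v z) = N * t k"
    using poly_op_z_interpolates by blast
  have vg: "poly_op n a v z0 i = g i" if i: "i < n" for i
  proof -
    have "poly_op n a v z0 i - g i = 0"
    proof (rule nonsingular[OF _ i])
      fix k assume k: "k < n"
      have "N * inner n ((mat_op n a ^^ k) ones) (poly_op n a v z0)
          = inner n ((mat_op n a ^^ k) ones) (\<lambda>i. N * poly_op n a v z0 i)"
        by (simp add: inner_scale_right)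
      also have "\<dots> = inner n ((mat_op n a ^^ k) ones) (\<lambda>i. 2 * D * poly_op n a v z i)"
        by (rule inner_cong) (simp_all add: poly_op_z_z0)
      also have "\<dots> = 2 * D * (N * t k)" by (simp only: inner_scale_right v[OF k])
      also have "\<dots> = N * inner n ((mat_op n a ^^ k) ones) g" using t[OF k] by simp
      finally have "inner n ((mat_op n a ^^ k) ones) (poly_op n a v z0) = inner n ((mat_op n a ^^ k) ones) g"
        using N_nonzero by simp
      then show "inner n ((mat_op n a ^^ k) ones) (\<lambda>i. poly_op n a v z0 i - g i) = 0"
        by (simp add: inner_diff_right)
    qed
    then show ?thesis by simp
  qed
  have "of_int (2 * k) * v \<in> lattice_ideal"
    using assms ring_idealD(4)[OF ring_ideal_lattice_ideal] by blast
  then have "2 * D dvd 2 * (k * g i)" if "i < n" for i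
    using that vg unfolding lattice_ideal_z0 poly_op_mult poly_op_of_int by simp
  then have "D dvd k * g i" if "i < n" for i using that by (simp only: dvd_mult_cancel_left) simp
  then have "D * 1 dvd inner n (\<lambda>i. k * g i) h" by (intro inner_dvd_mult) simp_all
  then show ?thesis using primitive by (simp add: inner_scale_left)
qed

text \<open>Both \<open>x\<^sup>T A x\<close> and \<open>x\<^sup>T x - e\<^sup>T x\<close> are even for integral \<open>x\<close>.\<close>

lemma even_inner_z0: "even (inner n z0 (poly_op n a s z0))"
proof -
  have pow: "even (inner n z0 ((mat_op n a ^^ k) z0))" for k
  proof (cases "even k")
    case True
    then obtain j where j: "k = j + j" by (metis evenE mult_2)
    define w where "w = (mat_op n a ^^ j) z0"
    have "inner n z0 ((mat_op n a ^^ k) z0) = inner n w w"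
      unfolding w_def j by (simp only: inner_funpow_shift) (rule inner_funpow[symmetric])
    also have "even \<dots> \<longleftrightarrow> even (inner n ones w)"
    proof -
      have "even (inner n w w - inner n ones w)"
        unfolding inner_def sum_subtractf[symmetric] by (rule dvd_sum) simp
      then show ?thesis by simp
    qed
    also have "inner n ones w = inner n ((mat_op n a ^^ j) ones) z0" by (simp add: w_def inner_funpow)
    also have "2 * D dvd inner n ((mat_op n a ^^ j) ones) z0" by (rule inner_walk_dvd) (simp add: z0)
    then have "even (inner n ((mat_op n a ^^ j) ones) z0)" using dvd_mult_left by blast
    finally show ?thesis by blast
  next
    case False
    then obtain j where j: "k = j + Suc j" by (metis oddE mult_2 Suc_eq_plus1 add_Suc_right)
    define w where "w = (mat_op n a ^^ j) z0"
    have "inner n z0 ((mat_op n a ^^ k) z0) = inner n w (mat_op n a w)"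
      unfolding w_def j using inner_funpow_shift[of j z0 "Suc j" z0] inner_funpow[of "j + Suc j" z0 z0] by simp
    also have "\<dots> = (\<Sum>i<n. \<Sum>l<n. w i * a i l * w l)"
      by (simp add: inner_def mat_op_def sum_distrib_left mult.assoc)
    also have "even \<dots>" by (rule even_symmetric_double_sum) (simp_all add: sym diag)
    finally show ?thesis .
  qed
  then show ?thesis by (auto simp: poly_op_def inner_sum_right inner_scale_right intro!: dvd_sum)
qed

text \<open>The pairing of f with s(A) f is that of \<open>z0\<close> with s(A) z0 divided by 4 D^2,
  and the numerator is even. This supplies the odd constant D^2 for the argument at 2.\<close>

lemma in_dual_ideal: "of_int (2 * D\<^sup>2) \<in> dual_ideal"
proof -
  have "N\<^sup>2 dvd walk_functional n a (r * (of_int (2 * D\<^sup>2) * s) * r)" for s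
  proof -
    let ?X = "inner n z (poly_op n a s z)"
    obtain q where q: "inner n z0 (poly_op n a s z0) = 2 * q" using even_inner_z0 by blast
    have "2 * D * (2 * D * ?X) = inner n (\<lambda>i. 2 * D * z i) (\<lambda>i. 2 * D * poly_op n a s z i)"
      by (simp only: inner_scale_left inner_scale_right)
    also have "\<dots> = inner n (\<lambda>i. N * z0 i) (\<lambda>i. N * poly_op n a s z0 i)"
      by (rule inner_cong) (simp_all only: z_z0 poly_op_z_z0)
    also have "\<dots> = N * (N * (2 * q))" by (simp only: inner_scale_left inner_scale_right q)
    finally have "2 * D\<^sup>2 * ?X = N\<^sup>2 * q" by (simp add: power2_eq_square)
    moreover have "walk_functional n a (r * (of_int (2 * D\<^sup>2) * s) * r) = 2 * D\<^sup>2 * ?X"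
      using inner_z_z[of 1 "of_int (2 * D\<^sup>2) * s"]
      by (simp only: poly_op_1 poly_op_mult poly_op_of_int inner_scale_right mult_1_right mult.assoc)
    ultimately show ?thesis by simp
  qed
  then show ?thesis by (simp add: dual_ideal_def)
qed

end

theorem smith_walk_op_unique_mate:
  fixes p b :: int
  assumes A: "smith_walk_op n a r N D z0 g h"
    and D: "prime p" "odd p" "odd b" "squarefree b" "\<not> p dvd b" "D = p\<^sup>2 * b"
    and A1: "walk_op n a1 r N" and A2: "walk_op n a2 r N"
    and walk: "\<And>q. walk_functional n a1 q = walk_functional n a q"
      "\<And>q. walk_functional n a2 q = walk_functional n a q"
  shows "walk_op.lattice_ideal n a r N = walk_op.lattice_ideal n a1 r N
    \<or> walk_op.lattice_ideal n a r N = walk_op.lattice_ideal n a2 r N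
    \<or> walk_op.lattice_ideal n a1 r N = walk_op.lattice_ideal n a2 r N"
proof -
  interpret A: smith_walk_op n a r N D z0 g h by (rule A)
  interpret A1: walk_op n a1 r N by (rule A1)
  interpret A2: walk_op n a2 r N by (rule A2)
  obtain l where l: "2 * [:- l, 1:] \<in> A.lattice_ideal" using A.root_in_lattice_ideal by blast
  interpret cyclic_self_annihilating A.dual_ideal A.lattice_ideal p b l D
    using D l A.ring_ideal_dual_ideal A.self_annihilating_lattice_ideal A.twoD_in_lattice_ideal
      A.order_in_lattice_ideal by unfold_locales auto
  have dual: "A1.dual_ideal = A.dual_ideal" "A2.dual_ideal = A.dual_ideal"
    by (simp_all only: A.dual_ideal_def A1.dual_ideal_def A2.dual_ideal_def walk)
  show ?thesis
    using at_most_two_self_annihilating[OF _ A.in_dual_ideal]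
      A1.self_annihilating_lattice_ideal A2.self_annihilating_lattice_ideal A.D_odd
    unfolding dual by simp
qed

subsection \<open>Cospectrality and walk counts\<close>

text \<open>The matrix determinant lemma for J = e e^T. The bordered matrix \<open>?B\<close> is
  reduced from the right by \<open>?R\<close> and from the left by \<open>?L\<close>. The adjugate
  replaces the inverse, so polynomial entries are allowed; the surplus factor det M is cancelled at
  the end.\<close>

lemma det_add_all_ones:
  fixes M :: "'a :: idom mat"
  assumes M: "M \<in> carrier_mat n n" and nz: "det M \<noteq> 0"
  shows "det (M + mat n n (\<lambda>_. 1)) = det M + (\<Sum>i<n. \<Sum>j<n. adj_mat M $$ (i, j))"
proof -
  let ?J = "mat n n (\<lambda>_. 1) :: 'a mat"
  let ?e = "mat n 1 (\<lambda>_. 1) :: 'a mat"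
  let ?f = "mat 1 n (\<lambda>_. 1) :: 'a mat"
  let ?B = "four_block_mat M (- ?e) ?f (1\<^sub>m 1)"
  let ?R = "four_block_mat (1\<^sub>m n) (0\<^sub>m n 1) (- ?f) (1\<^sub>m 1)"
  let ?L = "four_block_mat (1\<^sub>m n) (0\<^sub>m n 1) (- (?f * adj_mat M)) (det M \<cdot>\<^sub>m 1\<^sub>m 1)"
  note adj = adj_mat[OF M]
  have e: "?e \<in> carrier_mat n 1" "- ?e \<in> carrier_mat n 1" and f: "?f \<in> carrier_mat 1 n" "- ?f \<in> carrier_mat 1 n"
    and one: "1\<^sub>m 1 \<in> carrier_mat 1 1" and fa: "- (?f * adj_mat M) \<in> carrier_mat 1 n"
    using adj(1) by auto
  have J: "M + ?J \<in> carrier_mat n n" using M by auto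
  have B: "?B \<in> carrier_mat (n + 1) (n + 1)" using M by auto
  have R: "?R \<in> carrier_mat (n + 1) (n + 1)" and L: "?L \<in> carrier_mat (n + 1) (n + 1)"
    by (rule four_block_carrier_mat; simp)+
  have "?B * ?R = four_block_mat (M + ?J) (- ?e) (0\<^sub>m 1 n) (1\<^sub>m 1)"
  proof -
    have "M * 1\<^sub>m n + - ?e * - ?f = M + ?J"
      by (rule eq_matI) (use M in \<open>auto simp: scalar_prod_def\<close>)
    moreover have "M * 0\<^sub>m n 1 + - ?e * 1\<^sub>m 1 = - ?e" using M e by auto
    moreover have "?f * 1\<^sub>m n + 1\<^sub>m 1 * - ?f = 0\<^sub>m 1 n" using f by auto
    moreover have "?f * 0\<^sub>m n 1 + 1\<^sub>m 1 * 1\<^sub>m 1 = (1\<^sub>m 1 :: 'a mat)" using f by auto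
    ultimately show ?thesis
      using mult_four_block_mat[OF M e(2) f(1) one _ _ f(2) one, of "1\<^sub>m n" "0\<^sub>m n 1"] by simp
  qed
  then have "det (?B * ?R) = det (M + ?J)"
    using det_four_block_mat_lower_left_zero[OF J e(2) refl one] by simp
  moreover have "det ?R = 1"
    using det_four_block_mat_upper_right_zero[OF one_carrier_mat refl f(2) one] by simp
  ultimately have detB: "det ?B = det (M + ?J)"
    using det_mult[OF B R] by simp
  have "?L * ?B = four_block_mat M (- ?e) (0\<^sub>m 1 n) (?f * adj_mat M * ?e + det M \<cdot>\<^sub>m 1\<^sub>m 1)"
  proof -
    have "1\<^sub>m n * M + 0\<^sub>m n 1 * ?f = M" using M by auto
    moreover have "1\<^sub>m n * - ?e + 0\<^sub>m n 1 * 1\<^sub>m 1 = - ?e" using e by auto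
    moreover have "- (?f * adj_mat M) * M + det M \<cdot>\<^sub>m 1\<^sub>m 1 * ?f = 0\<^sub>m 1 n"
    proof -
      have "- (?f * adj_mat M) * M = - (?f * (adj_mat M * M))"
        using f adj M by (simp add: assoc_mult_mat[of _ 1 n _ n _ n])
      also have "\<dots> = - (det M \<cdot>\<^sub>m ?f)"
        unfolding adj(3) using f by (simp add: mult_smult_distrib[of _ 1 n _ n])
      finally show ?thesis using f by (intro eq_matI) auto
    qed
    moreover have "- (?f * adj_mat M) * - ?e + det M \<cdot>\<^sub>m 1\<^sub>m 1 * 1\<^sub>m 1
        = ?f * adj_mat M * ?e + det M \<cdot>\<^sub>m 1\<^sub>m 1"
      using adj(1) by (intro eq_matI) (auto simp: scalar_prod_def)
    ultimately show ?thesis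
      using mult_four_block_mat[OF one_carrier_mat[of n] zero_carrier_mat[of n 1] fa _ M e(2) f(1) one,
          of "det M \<cdot>\<^sub>m 1\<^sub>m 1"] by simp
  qed
  moreover have "det (?f * adj_mat M * ?e + det M \<cdot>\<^sub>m 1\<^sub>m 1) = det M + (\<Sum>i<n. \<Sum>j<n. adj_mat M $$ (i, j))"
  proof -
    have "(?f * adj_mat M * ?e) $$ (0, 0) = (\<Sum>j<n. \<Sum>i<n. adj_mat M $$ (i, j))"
      using adj(1) by (simp add: scalar_prod_def atLeast0LessThan)
    also have "\<dots> = (\<Sum>i<n. \<Sum>j<n. adj_mat M $$ (i, j))" by (rule sum.swap)
    finally show ?thesis using adj(1) by (subst det_single) auto
  qed
  ultimately have "det (?L * ?B) = det M * (det M + (\<Sum>i<n. \<Sum>j<n. adj_mat M $$ (i, j)))"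
    using det_four_block_mat_lower_left_zero[OF M e(2) refl, of "?f * adj_mat M * ?e + det M \<cdot>\<^sub>m 1\<^sub>m 1"] adj(1)
    by simp
  moreover have "det ?L = det M"
    using det_four_block_mat_upper_right_zero[OF one_carrier_mat refl fa, of "det M \<cdot>\<^sub>m 1\<^sub>m 1"]
    by (simp add: det_single)
  moreover have "det (?L * ?B) = det ?L * det ?B" by (rule det_mult[OF L B])
  ultimately show ?thesis using nz detB by simp
qed

lemma spectrum_mset_eq_imp_char_poly_eq:
  fixes A B :: "int mat"
  assumes A: "A \<in> carrier_mat n n" and B: "B \<in> carrier_mat n' n'"
    and eq: "spectrum_mset A = spectrum_mset B"
  shows "char_poly A = char_poly B" "n = n'"
proof -
  let ?c = "\<lambda>M :: int mat. map_mat of_int M :: complex mat"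
  have monic: "lead_coeff (char_poly (?c M)) = 1" if "M \<in> carrier_mat k k" for M k
    using degree_monic_char_poly[of "?c M" k] that by auto
  have "(\<Prod>x\<in>#spectrum_mset M. [:- x, 1:]) = char_poly (?c M)" if "M \<in> carrier_mat k k" for M k
    using complex_poly_decompose_multiset[of "char_poly (?c M)"] monic[OF that]
    by (simp add: spectrum_mset_def)
  then have "char_poly (?c A) = char_poly (?c B)" using A B eq by metis
  then have "map_poly of_int (char_poly A) = (map_poly of_int (char_poly B) :: complex poly)"
    using of_int_hom.char_poly_hom[OF A] of_int_hom.char_poly_hom[OF B] by metis
  then show "char_poly A = char_poly B" by simp
  then show "n = n'" using degree_monic_char_poly[OF A] degree_monic_char_poly[OF B] by metis
qed

lemma poly_char_poly:
  assumes "A \<in> carrier_mat n n"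
  shows "poly (char_poly A) s = det (mat n n (\<lambda>(i, j). (if i = j then s else 0) - A $$ (i, j)))"
  unfolding char_poly_def
  by (rule poly_det_cong[where n = n]) (use assms in \<open>auto simp: char_poly_matrix_def\<close>)

text \<open>s I - (A - J) is the negative of (-1 - s) I - (J - I - A), so the spectrum of the
  complement is that of the rank-one perturbation A - J in other coordinates.\<close>

lemma char_poly_complement:
  fixes A :: "int mat"
  assumes A: "A \<in> carrier_mat n n"
  shows "poly (char_poly (A - mat n n (\<lambda>_. 1))) s
    = (- 1) ^ n * poly (char_poly (mat n n (\<lambda>_. 1) - 1\<^sub>m n - A)) (- 1 - s)"
proof -
  let ?M = "mat n n (\<lambda>(i, j). (if i = j then s else 0) - (A - mat n n (\<lambda>_. 1)) $$ (i, j))"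
  have "mat n n (\<lambda>(i, j). (if i = j then - 1 - s else 0) - (mat n n (\<lambda>_. 1) - 1\<^sub>m n - A) $$ (i, j))
      = (- 1) \<cdot>\<^sub>m ?M"
    by (rule eq_matI) (use A in auto)
  then have "poly (char_poly (mat n n (\<lambda>_. 1) - 1\<^sub>m n - A)) (- 1 - s) = (- 1) ^ n * det ?M"
    using A by (subst poly_char_poly[of _ n]) (auto simp: det_smult)
  then show ?thesis
    using A by (subst poly_char_poly[of _ n]) (auto simp: power_mult_distrib[symmetric] mult.assoc[symmetric])
qed

text \<open>Together with the complement identity, this shows that the generalized spectrum
  determines e^T adj(t - A) e, the numerator of the generating function of walks.\<close>

lemma char_poly_minus_all_ones:
  fixes A :: "int mat"
  assumes A: "A \<in> carrier_mat n n"
  shows "char_poly (A - mat n n (\<lambda>_. 1))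
    = char_poly A + (\<Sum>i<n. \<Sum>j<n. adj_mat (char_poly_matrix A) $$ (i, j))"
proof -
  have "char_poly_matrix (A - mat n n (\<lambda>_. 1)) = char_poly_matrix A + mat n n (\<lambda>_. 1)"
    by (rule eq_matI) (use A in \<open>auto simp: char_poly_matrix_def one_pCons\<close>)
  moreover have "char_poly A \<noteq> 0" using degree_monic_char_poly[OF A] by auto
  ultimately show ?thesis using det_add_all_ones[of "char_poly_matrix A" n] A by (simp add: char_poly_def)
qed

lemma pow_mat_mult_vec:
  assumes A: "A \<in> carrier_mat n n" and "v \<in> carrier_vec n" "i < n"
  shows "(A ^\<^sub>m k *\<^sub>v v) $ i = (mat_op n (\<lambda>i j. A $$ (i, j)) ^^ k) (\<lambda>j. v $ j) i"
  using assms(2)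
proof (induction k arbitrary: v)
  case 0
  then show ?case using A assms(3) by simp
next
  case (Suc k)
  let ?a = "\<lambda>i j. A $$ (i, j)"
  have Av: "A *\<^sub>v v \<in> carrier_vec n" using A Suc by auto
  have "(A ^\<^sub>m Suc k *\<^sub>v v) $ i = (A ^\<^sub>m k *\<^sub>v (A *\<^sub>v v)) $ i"
    using A Suc by (simp add: assoc_mult_mat_vec[of _ n n _ n])
  also have "\<dots> = (mat_op n ?a ^^ k) (\<lambda>j. (A *\<^sub>v v) $ j) i" by (rule Suc.IH[OF Av])
  also have "\<dots> = poly_op n ?a (monom 1 k) (\<lambda>j. (A *\<^sub>v v) $ j) i" by (simp add: poly_op_monom)
  also have "\<dots> = poly_op n ?a (monom 1 k) (mat_op n ?a (\<lambda>j. v $ j)) i"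
  proof (rule poly_op_cong[OF _ assms(3)])
    fix j assume "j < n"
    then show "(A *\<^sub>v v) $ j = mat_op n ?a (\<lambda>j. v $ j) j"
      using A Suc(2) by (simp add: mat_op_def scalar_prod_def atLeast0LessThan)
  qed
  also have "\<dots> = (mat_op n ?a ^^ Suc k) (\<lambda>j. v $ j) i" by (simp add: poly_op_monom funpow_swap1)
  finally show ?case .
qed

lemma adj_char_poly_matrix_rec:
  fixes A :: "int mat"
  assumes A: "A \<in> carrier_mat n n" and i: "i < n"
  defines "d \<equiv> \<lambda>i. \<Sum>j<n. adj_mat (char_poly_matrix A) $$ (i, j)"
  shows "char_poly A = pCons 0 (d i) - (\<Sum>l<n. Polynomial.smult (A $$ (i, l)) (d l))"
proof -
  let ?M = "char_poly_matrix A"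
  have M: "?M \<in> carrier_mat n n" using A by simp
  note adj = adj_mat[OF M]
  have M_entry: "?M $$ (i, l) = (if l = i then [:0, 1:] else 0) - [:A $$ (i, l):]" if "l < n" for l
    using A i that by (simp add: char_poly_matrix_def)
  have "char_poly A = (\<Sum>j<n. (det ?M \<cdot>\<^sub>m 1\<^sub>m n) $$ (i, j))"
    using i by (simp add: char_poly_def if_distrib cong: if_cong)
  also have "\<dots> = (\<Sum>j<n. (?M * adj_mat ?M) $$ (i, j))" by (simp only: adj(2))
  also have "\<dots> = (\<Sum>j<n. \<Sum>l<n. ?M $$ (i, l) * adj_mat ?M $$ (l, j))"
    using M adj(1) i by (intro sum.cong refl) (simp add: scalar_prod_def atLeast0LessThan)
  also have "\<dots> = (\<Sum>l<n. \<Sum>j<n. ?M $$ (i, l) * adj_mat ?M $$ (l, j))" by (rule sum.swap)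
  also have "\<dots> = (\<Sum>l<n. ?M $$ (i, l) * d l)" by (simp add: d_def sum_distrib_left)
  also have "\<dots> = (\<Sum>l<n. (if l = i then pCons 0 (d i) else 0) - Polynomial.smult (A $$ (i, l)) (d l))"
    by (intro sum.cong refl) (auto simp: M_entry algebra_simps)
  also have "\<dots> = pCons 0 (d i) - (\<Sum>l<n. Polynomial.smult (A $$ (i, l)) (d l))"
    using i by (simp add: sum_subtractf)
  finally show ?thesis .
qed

text \<open>Comparing coefficients in \<open>(t - A) adj(t - A) e = \<chi>(t) e\<close> expresses the coefficients of
  \<open>adj(t - A) e\<close> through the vectors \<open>A\<^sup>j e\<close>.\<close>

lemma adj_char_poly_matrix_coeff:
  fixes A :: "int mat"
  assumes A: "A \<in> carrier_mat n n"
  defines "a \<equiv> \<lambda>i j. A $$ (i, j)"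
    and "d \<equiv> \<lambda>k i. coeff (\<Sum>j<n. adj_mat (char_poly_matrix A) $$ (i, j)) k"
  shows "m \<le> n \<Longrightarrow> i < n \<Longrightarrow> d (n - m) i
      = (\<Sum>j<m. coeff (char_poly A) (n - m + 1 + j) * (mat_op n a ^^ j) ones i)"
    and "i < n \<Longrightarrow> (mat_op n a ^^ n) ones i
      = (\<Sum>j<n. - coeff (char_poly A) j * (mat_op n a ^^ j) ones i)"
proof -
  let ?c = "coeff (char_poly A)"
  have deg: "degree (char_poly A) = n" "?c n = 1" using degree_monic_char_poly[OF A] by auto
  have rec: "?c (Suc k) = d k i - mat_op n a (d (Suc k)) i"
    and rec0: "?c 0 = - mat_op n a (d 0) i" if "i < n" for k i
    by (subst adj_char_poly_matrix_rec[OF A that];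
        simp add: d_def a_def mat_op_def coeff_sum)+
  obtain K where K: "\<And>k i. k \<ge> K \<Longrightarrow> i < n \<Longrightarrow> d k i = 0"
  proof -
    let ?D = "\<lambda>i. degree (\<Sum>j<n. adj_mat (char_poly_matrix A) $$ (i, j))"
    have "d k i = 0" if "k \<ge> Suc (\<Sum>i<n. ?D i)" "i < n" for k i
    proof -
      have "?D i \<le> (\<Sum>i<n. ?D i)" by (rule member_le_sum) (use that in auto)
      then show ?thesis unfolding d_def by (intro coeff_eq_0) (use that in linarith)
    qed
    then show ?thesis by (rule that)
  qed
  \<comment> \<open>Downward induction from the crude bound \<open>K\<close>: by \<open>rec\<close>,
    d_k is c_(k+1) + A d_(k+1), and c_(k+1) = 0 for k \<ge> n.\<close>
  have zero: "d (n + k) i = 0" if "i < n" for k i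
  proof (cases "K \<le> n + k")
    case False
    then show ?thesis using that
    proof (induction "K - (n + k)" arbitrary: k i)
      case (Suc x)
      have "d (n + Suc k) j = 0" if "j < n" for j
      proof (cases "K \<le> n + Suc k")
        case False
        then show ?thesis using Suc(1)[of "Suc k" j] Suc(2) that by simp
      qed (use K that in blast)
      then have "mat_op n a (d (n + Suc k)) i = 0" by (simp add: mat_op_def)
      moreover have "?c (Suc (n + k)) = 0" by (rule coeff_eq_0) (simp add: deg)
      ultimately show ?case using rec[OF Suc(4), of "n + k"] by simp
    qed simp
  qed (use K that in blast)
  have step: "mat_op n a (\<lambda>i. \<Sum>j<m. f j * (mat_op n a ^^ j) ones i) i
      = (\<Sum>j<m. f j * (mat_op n a ^^ Suc j) ones i)" for m f i
    by (simp add: mat_op_sum mat_op_scale)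
  have formula: "m \<le> n \<Longrightarrow> i < n \<Longrightarrow>
    d (n - m) i = (\<Sum>j<m. ?c (n - m + 1 + j) * (mat_op n a ^^ j) ones i)" for m i
  proof (induction m arbitrary: i)
    case 0
    then show ?case using zero[of i 0] by simp
  next
    case (Suc m)
    then have idx: "Suc (n - Suc m) = n - m" by simp
    have "d (n - Suc m) i = ?c (n - m) + mat_op n a (d (n - m)) i"
      using rec[OF Suc(3), of "n - Suc m"] by (simp add: idx)
    also have "mat_op n a (d (n - m)) = mat_op n a (\<lambda>i. \<Sum>j<m. ?c (n - m + 1 + j) * (mat_op n a ^^ j) ones i)"
      by (rule mat_op_cong) (use Suc in simp)
    also have "?c (n - m) + \<dots> i = (\<Sum>j<Suc m. ?c (n - m + j) * (mat_op n a ^^ j) ones i)"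
      by (simp add: step sum.lessThan_Suc_shift del: sum.lessThan_Suc funpow.simps; simp)
    finally show ?case using idx by (simp del: sum.lessThan_Suc)
  qed
  show "m \<le> n \<Longrightarrow> i < n \<Longrightarrow> d (n - m) i = (\<Sum>j<m. ?c (n - m + 1 + j) * (mat_op n a ^^ j) ones i)"
    by (rule formula)
  assume i: "i < n"
  \<comment> \<open>The constant coefficient closes the recursion and gives Cayley-Hamilton applied
    to e.\<close>
  have "mat_op n a (d 0) = mat_op n a (\<lambda>i. \<Sum>j<n. ?c (1 + j) * (mat_op n a ^^ j) ones i)"
    by (rule mat_op_cong) (use formula[of n] in simp)
  then have "?c 0 + (\<Sum>j<n. ?c (Suc j) * (mat_op n a ^^ Suc j) ones i) = 0"
    using rec0[OF i] by (simp add: step del: funpow.simps)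
  moreover have "(\<Sum>j<Suc n. ?c j * (mat_op n a ^^ j) ones i)
      = ?c 0 + (\<Sum>j<n. ?c (Suc j) * (mat_op n a ^^ Suc j) ones i)"
    by (simp add: sum.lessThan_Suc_shift del: sum.lessThan_Suc funpow.simps; simp)
  ultimately have "(\<Sum>j<n. ?c j * (mat_op n a ^^ j) ones i) + (mat_op n a ^^ n) ones i = 0"
    by (simp add: deg)
  then show "(mat_op n a ^^ n) ones i = (\<Sum>j<n. - ?c j * (mat_op n a ^^ j) ones i)"
    by (simp add: sum_negf)
qed

text \<open>The coefficient of t^(n-1-k) in e^T adj(t - A) e is a combination of the walk counts up
  to k whose last weight is the leading coefficient 1 of the characteristic polynomial. So the
  counts below n are recovered one by one; from n on they satisfy the recurrence of that
  polynomial.\<close>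

lemma walk_functional_eqI:
  fixes A B :: "int mat"
  assumes A: "A \<in> carrier_mat n n" and B: "B \<in> carrier_mat n n"
    and char: "char_poly A = char_poly B"
    and compl: "char_poly (mat n n (\<lambda>_. 1) - 1\<^sub>m n - A) = char_poly (mat n n (\<lambda>_. 1) - 1\<^sub>m n - B)"
  shows "walk_functional n (\<lambda>i j. A $$ (i, j)) p = walk_functional n (\<lambda>i j. B $$ (i, j)) p"
proof -
  let ?op = "\<lambda>M :: int mat. mat_op n (\<lambda>i j. M $$ (i, j))"
  let ?mom = "\<lambda>M k. inner n ones ((?op M ^^ k) ones)"
  let ?s = "\<lambda>M :: int mat. \<Sum>i<n. \<Sum>j<n. adj_mat (char_poly_matrix M) $$ (i, j)"
  let ?c = "coeff (char_poly A)"
  have deg: "?c n = 1" using degree_monic_char_poly[OF A] by simp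
  have "char_poly (A - mat n n (\<lambda>_. 1)) = char_poly (B - mat n n (\<lambda>_. 1))"
    by (rule poly_ext) (simp add: char_poly_complement[OF A] char_poly_complement[OF B] compl)
  then have s: "?s A = ?s B"
    using char_poly_minus_all_ones[OF A] char_poly_minus_all_ones[OF B] char by simp
  have sum: "coeff (?s M) (n - m) = (\<Sum>j<m. coeff (char_poly M) (n - m + 1 + j) * ?mom M j)"
    if M: "M \<in> carrier_mat n n" and m: "m \<le> n" for M m
  proof -
    have "coeff (?s M) (n - m) = (\<Sum>i<n. \<Sum>j<m. coeff (char_poly M) (n - m + 1 + j) * (?op M ^^ j) ones i)"
      unfolding coeff_sum[of _ "{..<n}"]
      using adj_char_poly_matrix_coeff(1)[OF M m] by (intro sum.cong[OF refl]) (simp add: coeff_sum)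
    also have "\<dots> = (\<Sum>j<m. \<Sum>i<n. coeff (char_poly M) (n - m + 1 + j) * (?op M ^^ j) ones i)"
      by (rule sum.swap)
    finally show ?thesis by (simp add: inner_def sum_distrib_left)
  qed
  have rec: "?mom M (n + t) = (\<Sum>j<n. - coeff (char_poly M) j * ?mom M (j + t))"
    if M: "M \<in> carrier_mat n n" for M t
  proof -
    have "(?op M ^^ (n + t)) ones i = (\<Sum>j<n. - coeff (char_poly M) j * (?op M ^^ (j + t)) ones i)"
      if i: "i < n" for i
    proof -
      have shift: "(?op M ^^ (j + t)) ones = (?op M ^^ t) ((?op M ^^ j) ones)" for j
        by (simp add: add.commute[of j] funpow_add)
      have "(?op M ^^ t) ((?op M ^^ n) ones) i
          = (?op M ^^ t) (\<lambda>i. \<Sum>j<n. - coeff (char_poly M) j * (?op M ^^ j) ones i) i"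
        unfolding poly_op_monom[symmetric]
        by (rule poly_op_cong[OF _ i]) (simp only: poly_op_monom adj_char_poly_matrix_coeff(2)[OF M])
      then show ?thesis by (simp only: shift mat_op_funpow_sum mat_op_funpow_scale)
    qed
    then have "?mom M (n + t) = inner n ones (\<lambda>i. \<Sum>j<n. - coeff (char_poly M) j * (?op M ^^ (j + t)) ones i)"
      by (intro inner_cong) auto
    then show ?thesis by (simp only: inner_sum_right inner_scale_right)
  qed
  have mom: "?mom A k = ?mom B k" for k
  proof (induction k rule: less_induct)
    case (less k)
    show ?case
    proof (cases "k < n")
      case True
      then have idx: "n - Suc k + 1 + k = n" and le: "Suc k \<le> n" by auto
      have "(\<Sum>j<Suc k. ?c (n - Suc k + 1 + j) * ?mom A j) = (\<Sum>j<Suc k. ?c (n - Suc k + 1 + j) * ?mom B j)"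
        using sum[OF A le] sum[OF B le] s char by metis
      moreover have "(\<Sum>j<k. ?c (n - Suc k + 1 + j) * ?mom A j) = (\<Sum>j<k. ?c (n - Suc k + 1 + j) * ?mom B j)"
        using less by (intro sum.cong) auto
      ultimately show ?thesis unfolding sum.lessThan_Suc idx deg by simp
    next
      case False
      then obtain t where t: "k = n + t" using le_Suc_ex by (metis not_less)
      have "?mom A k = (\<Sum>j<n. - ?c j * ?mom A (j + t))" unfolding t by (rule rec[OF A])
      also have "\<dots> = (\<Sum>j<n. - ?c j * ?mom B (j + t))" using less t by (intro sum.cong) auto
      also have "\<dots> = ?mom B k" unfolding t char by (rule rec[OF B, symmetric])
      finally show ?thesis .
    qed
  qed
  show ?thesis
    unfolding walk_functional_def poly_op_def inner_sum_right inner_scale_right mom ..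
qed

subsection \<open>The Smith normal form of the walk matrix\<close>

lemma mk_diagonal_index:
  assumes "i < length xs" "j < length xs"
  shows "mk_diagonal xs $$ (i, j) = (if i = j then xs ! i else 0)"
  using assms
proof (induction xs arbitrary: i j)
  case (Cons x xs)
  have step: "mk_diagonal (x # xs) = four_block_mat (mat 1 1 (\<lambda>_. x)) (0\<^sub>m 1 (length xs))
      (0\<^sub>m (length xs) 1) (mk_diagonal xs)"
    using mk_diagonal_dim[of xs] by (simp add: mk_diagonal_def Let_def)
  show ?case
    unfolding step using Cons mk_diagonal_dim[of xs] by (auto simp: nth_Cons')
qed simp

lemma invertible_matE:
  assumes "invertible_mat U" "U \<in> carrier_mat n n"
  obtains U' where "U' \<in> carrier_mat n n" "U * U' = 1\<^sub>m n" "U' * U = 1\<^sub>m n"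
proof -
  obtain U' where U': "U * U' = 1\<^sub>m n" "U' * U = 1\<^sub>m (dim_row U')"
    using assms by (auto simp: invertible_mat_def inverts_mat_def)
  have "dim_col U' = n" using arg_cong[OF U'(1), of dim_col] by simp
  moreover have "dim_row U' = n" using arg_cong[OF U'(2), of dim_col] assms(2) by simp
  ultimately show ?thesis using that[of U'] U' by auto
qed

text \<open>The inverse of \<open>W\<^sup>T\<close>, multiplied by \<open>2D\<close>, is integral and of rank one modulo \<open>D\<close>.\<close>

lemma smith_transpose_solvable:
  fixes W U V S :: "int mat" and s :: "nat \<Rightarrow> int"
  assumes W: "W \<in> carrier_mat n n" and U: "U \<in> carrier_mat n n" "invertible_mat U"
    and V: "V \<in> carrier_mat n n" "invertible_mat V" and S: "S = U * W * V"
    and S_entry: "\<And>i j. i < n \<Longrightarrow> j < n \<Longrightarrow> S $$ (i, j) = (if i = j then s i else 0)"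
    and small: "\<And>i. i < n - 1 \<Longrightarrow> s i = 1 \<or> s i = 2" and last: "s (n - 1) = 2 * D"
    and D: "D \<noteq> 0" and n: "n > 0"
  defines "w \<equiv> \<lambda>k. inner n (\<lambda>i. W $$ (i, k))"
  shows "\<exists>y. \<forall>k<n. w k y = 2 * D * t k"
    and "\<exists>g h. inner n g h = 1 \<and> (\<forall>k<n. 2 * D dvd w k g) \<and>
      (\<forall>y. (\<forall>k<n. 2 * D dvd w k y) \<longrightarrow> (\<exists>c. \<forall>i<n. D dvd y i - c * g i))"
    and "(\<And>k. k < n \<Longrightarrow> w k y = 0) \<Longrightarrow> i < n \<Longrightarrow> y i = 0"
proof -
  obtain U' where U': "U' \<in> carrier_mat n n" "U * U' = 1\<^sub>m n" "U' * U = 1\<^sub>m n"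
    using invertible_matE[OF U(2,1)] .
  obtain V' where V': "V' \<in> carrier_mat n n" "V * V' = 1\<^sub>m n" "V' * V = 1\<^sub>m n"
    using invertible_matE[OF V(2,1)] .
  let ?X = "transpose_mat W"
  let ?P = "transpose_mat V'" and ?P' = "transpose_mat V"
  let ?Q = "transpose_mat U'" and ?Q' = "transpose_mat U"
  have Sc: "S \<in> carrier_mat n n" using S U W V by auto
  have car: "?X \<in> carrier_mat n n" "?P \<in> carrier_mat n n" "?P' \<in> carrier_mat n n"
    "?Q \<in> carrier_mat n n" "?Q' \<in> carrier_mat n n" using W U V U' V' by auto
  have St: "transpose_mat S = S" by (rule eq_matI) (use Sc S_entry in auto)
  have PP: "?P * ?P' = 1\<^sub>m n"
    unfolding transpose_mult[OF V(1) V'(1), symmetric] V'(2) by simp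
  have QQ: "?Q * ?Q' = 1\<^sub>m n"
    unfolding transpose_mult[OF U(1) U'(1), symmetric] U'(2) by simp
  have QQ': "?Q' * ?Q = 1\<^sub>m n"
    unfolding transpose_mult[OF U'(1) U(1), symmetric] U'(3) by simp
  \<comment> \<open>S is its own transpose, so the factorization of W becomes one of W^T, whose rows
    are the walk vectors against which \<open>w\<close> pairs.\<close>
  have SX: "S = ?P' * (?X * ?Q')"
  proof -
    have "transpose_mat S = ?P' * transpose_mat (U * W)"
      unfolding S by (rule transpose_mult[of _ n n]) (use U W V in auto)
    then show ?thesis using St transpose_mult[OF U(1) W] by simp
  qed
  have wX: "w k y = (?X *\<^sub>v vec n y) $ k" if "k < n" for k y
    using that W by (simp add: w_def inner_def scalar_prod_def atLeast0LessThan)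
  have Sv: "(S *\<^sub>v v) $ k = s k * v $ k" if "k < n" "v \<in> carrier_vec n" for k v
    using that Sc S_entry
    by (simp add: scalar_prod_def if_distrib[of "\<lambda>x. x * _"] cong: if_cong)
  have PSQ: "?X *\<^sub>v (?Q' *\<^sub>v v) = ?P *\<^sub>v (S *\<^sub>v v)" if v: "v \<in> carrier_vec n" for v
  proof -
    have "?P *\<^sub>v (S *\<^sub>v v) = ?P * ?P' *\<^sub>v (?X *\<^sub>v (?Q' *\<^sub>v v))"
      unfolding SX using car v by (simp add: assoc_mult_mat_vec[of _ n n _ n])
    then show ?thesis unfolding PP using car v by simp
  qed
  have SQ: "S *\<^sub>v (?Q *\<^sub>v v) = ?P' *\<^sub>v (?X *\<^sub>v v)" if v: "v \<in> carrier_vec n" for v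
  proof -
    have "S *\<^sub>v (?Q *\<^sub>v v) = ?P' *\<^sub>v (?X *\<^sub>v (?Q' * ?Q *\<^sub>v v))"
      unfolding SX using car v by (simp add: assoc_mult_mat_vec[of _ n n _ n])
    then show ?thesis unfolding QQ' using v by simp
  qed
  have recover: "v = ?Q' *\<^sub>v (?Q *\<^sub>v v)" if v: "v \<in> carrier_vec n" for v
  proof -
    have "?Q' *\<^sub>v (?Q *\<^sub>v v) = ?Q' * ?Q *\<^sub>v v"
      using car v by (simp only: assoc_mult_mat_vec[of _ n n _ n])
    then show ?thesis unfolding QQ' using v by simp
  qed
  have s_cases: "s i = 1 \<or> s i = 2 \<or> s i = 2 * D" if "i < n" for i
    using small[of i] last that by (cases "i = n - 1") auto
  have mult_vec_sum: "(M *\<^sub>v v) $ i = (\<Sum>l<n. M $$ (i, l) * v $ l)"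
    if "M \<in> carrier_mat n n" "v \<in> carrier_vec n" "i < n" for M :: "int mat" and v i
    using that by (simp add: scalar_prod_def atLeast0LessThan)
  have dvd_mult_vec: "m dvd (M *\<^sub>v v) $ i"
    if "M \<in> carrier_mat n n" "v \<in> carrier_vec n" "\<And>j. j < n \<Longrightarrow> m dvd v $ j" "i < n"
    for M :: "int mat" and v i m
    using that by (auto simp: scalar_prod_def intro!: dvd_sum)

  \<comment> \<open>\<open>q\<close> is the diagonal of 2 D S^-1; the solution \<open>x\<close> is
    U^T (2 D S^-1) V^T t.\<close>
  have "\<exists>q. s i * q = 2 * D" if "i < n" for i
    using s_cases[OF that] by (metis mult.commute mult.left_commute mult_1)
  then obtain q where q: "\<And>i. i < n \<Longrightarrow> s i * q i = 2 * D" by metis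
  define v where "v = ?P' *\<^sub>v vec n t"
  have v: "v \<in> carrier_vec n" using car by (auto simp: v_def)
  define x where "x = ?Q' *\<^sub>v vec n (\<lambda>i. q i * v $ i)"
  have x: "x \<in> carrier_vec n" using car by (auto simp: x_def)
  have "S *\<^sub>v vec n (\<lambda>i. q i * v $ i) = (2 * D) \<cdot>\<^sub>v v"
    by (rule eq_vecI) (use v Sc Sv q in \<open>auto simp: mult.assoc[symmetric] simp del: index_mult_mat_vec\<close>)
  moreover have "?P *\<^sub>v ((2 * D) \<cdot>\<^sub>v v) = (2 * D) \<cdot>\<^sub>v (?P *\<^sub>v v)"
    by (rule eq_vecI) (use car v in \<open>auto simp: scalar_prod_def sum_distrib_left mult.left_commute\<close>)
  ultimately have "?X *\<^sub>v x = (2 * D) \<cdot>\<^sub>v (?P *\<^sub>v v)"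
    unfolding x_def using PSQ[of "vec n (\<lambda>i. q i * v $ i)"] by simp
  also have "?P *\<^sub>v v = ?P * ?P' *\<^sub>v vec n t"
    unfolding v_def using car by (simp only: assoc_mult_mat_vec[of _ n n _ n] vec_carrier)
  finally have "?X *\<^sub>v x = (2 * D) \<cdot>\<^sub>v vec n t" unfolding PP by simp
  moreover have "vec n (\<lambda>i. x $ i) = x" using x by auto
  ultimately have "w k (\<lambda>i. x $ i) = 2 * D * t k" if "k < n" for k using that by (simp add: wX)
  then show "\<exists>y. \<forall>k<n. w k y = 2 * D * t k" by blast

  \<comment> \<open>The direction of the last invariant factor: a column of U^T and the matching row
    of its inverse, so they pair to 1.\<close>
  define g where "g = (\<lambda>i. ?Q' $$ (i, n - 1))"
  define h where "h = (\<lambda>i. ?Q $$ (n - 1, i))"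
  have "inner n g h = (?Q * ?Q') $$ (n - 1, n - 1)"
    using car n by (simp add: inner_def g_def h_def scalar_prod_def atLeast0LessThan mult.commute)
  then have gh: "inner n g h = 1" unfolding QQ using n by simp
  have g_vec: "vec n g = ?Q' *\<^sub>v unit_vec n (n - 1)"
    by (rule eq_vecI) (use car n in \<open>auto simp: g_def\<close>)
  have gdvd: "2 * D dvd w k g" if k: "k < n" for k
  proof -
    have dvd: "2 * D dvd (S *\<^sub>v unit_vec n (n - 1)) $ j" if "j < n" for j
      using Sv[OF that, of "unit_vec n (n - 1)"] last n that by (auto simp: unit_vec_def)
    have "2 * D dvd (?P *\<^sub>v (S *\<^sub>v unit_vec n (n - 1))) $ k"
      by (rule dvd_mult_vec[OF car(2) mult_mat_vec_carrier[OF Sc unit_vec_carrier] dvd k])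
    then show ?thesis unfolding wX[OF k] g_vec using PSQ[of "unit_vec n (n - 1)"] by simp
  qed
  have cyc: "\<exists>c. \<forall>i<n. D dvd y i - c * g i" if y: "\<forall>k<n. 2 * D dvd w k y" for y
  proof -
    let ?u = "?Q *\<^sub>v vec n y"
    have u: "?u \<in> carrier_vec n" using car by auto
    have "2 * D dvd (?X *\<^sub>v vec n y) $ j" if "j < n" for j using y wX[OF that] that by metis
    then have dvd: "2 * D dvd (?P' *\<^sub>v (?X *\<^sub>v vec n y)) $ j" if "j < n" for j
      by (rule dvd_mult_vec[OF car(3) mult_mat_vec_carrier[OF car(1) vec_carrier] _ that])
    have su: "2 * D dvd s j * ?u $ j" if "j < n" for j
      using dvd[OF that] SQ[OF vec_carrier] Sv[OF that u] by metis
    \<comment> \<open>As s_j is 1 or 2, cancelling it from 2 D | s_j u_j leaves at least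
      \<open>D\<close>. Only the last coordinate stays free modulo \<open>D\<close>, whence rank
      one.\<close>
    have uD: "D dvd ?u $ j" if j: "j < n - 1" for j
    proof -
      have "2 * D dvd s j * ?u $ j" using su j by simp
      then show ?thesis using small[OF j] by (auto dest: dvd_mult_right)
    qed
    have "D dvd y i - ?u $ (n - 1) * g i" if i: "i < n" for i
    proof -
      have "y i = (?Q' *\<^sub>v ?u) $ i" using recover[of "vec n y"] i by (metis index_vec vec_carrier)
      also have "\<dots> = (\<Sum>l<n. ?Q' $$ (i, l) * ?u $ l)"
        by (rule mult_vec_sum[OF car(5) u i])
      also have "{..<n} = insert (n - 1) {..<n - 1}" using n by auto
      finally have "y i - ?u $ (n - 1) * g i = (\<Sum>l<n - 1. ?Q' $$ (i, l) * ?u $ l)"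
        by (simp add: g_def)
      then show ?thesis using uD by (auto intro!: dvd_sum)
    qed
    then show ?thesis by blast
  qed
  show "\<exists>g h. inner n g h = 1 \<and> (\<forall>k<n. 2 * D dvd w k g) \<and>
      (\<forall>y. (\<forall>k<n. 2 * D dvd w k y) \<longrightarrow> (\<exists>c. \<forall>i<n. D dvd y i - c * g i))"
    using gh gdvd cyc by blast

  assume zero: "\<And>k. k < n \<Longrightarrow> w k y = 0" and i: "i < n"
  let ?u = "?Q *\<^sub>v vec n y"
  have u: "?u \<in> carrier_vec n" using car by auto
  have "?X *\<^sub>v vec n y = 0\<^sub>v n" by (rule eq_vecI) (use zero wX car in auto)
  then have "S *\<^sub>v ?u = 0\<^sub>v n" using SQ[of "vec n y"] car by auto
  then have "s j * ?u $ j = 0" if "j < n" for j using Sv[OF that u] that by simp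
  moreover have "s j \<noteq> 0" if "j < n" for j using s_cases[OF that] D by auto
  ultimately have "?u $ j = 0\<^sub>v n $ j" if "j < n" for j using that by (metis index_zero_vec(1) mult_eq_0_iff)
  then have "?u = 0\<^sub>v n" using carrier_vecD[OF u] by (metis eq_vecI index_zero_vec(2))
  then have "vec n y = 0\<^sub>v n" using recover[of "vec n y"] car by auto
  then show "y i = 0" using i by (metis index_vec index_zero_vec(1))
qed

subsection \<open>Graphs\<close>

abbreviation adjacency :: "'a pair_pre_digraph \<Rightarrow> nat \<Rightarrow> nat \<Rightarrow> int" where
  "adjacency G \<equiv> \<lambda>i j. adjacency_mat G $$ (i, j)"

lemma adjacency_mat_carrier: "adjacency_mat G \<in> carrier_mat (card (pverts G)) (card (pverts G))"
  by (simp add: adjacency_mat_def Let_def)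

lemma adjacency_eq:
  assumes "i < card (pverts G)" "j < card (pverts G)"
  shows "adjacency G i j = (if (vertex_list G ! i, vertex_list G ! j) \<in> parcs G then 1 else 0)"
  using assms by (simp add: adjacency_mat_def Let_def)

lemma adjacency_sym:
  assumes "pair_graph G"
  shows "sym_op (card (pverts G)) (adjacency G)"
proof
  interpret pair_graph G by fact
  have "(u, v) \<in> parcs G \<longleftrightarrow> (v, u) \<in> parcs G" for u v
    using pair_sym_arcs by (auto simp: symmetric_def sym_def)
  then show "adjacency G i j = adjacency G j i" if "i < card (pverts G)" "j < card (pverts G)" for i j
    using that by (simp add: adjacency_eq)
qed

lemma adjacency_diag:
  assumes "pair_graph G" "i < card (pverts G)"
  shows "adjacency G i i = 0"
proof -
  interpret pair_graph G by fact
  show ?thesis using pair_no_loops assms(2) by (force simp: adjacency_eq)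
qed

lemma graph_isomorphic_if_adjacency_permuted:
  assumes G: "pair_graph G" and H: "pair_graph H" and card: "card (pverts H) = card (pverts G)"
    and bij: "bij_betw \<sigma> {..<card (pverts G)} {..<card (pverts G)}"
    and eq: "\<And>i j. i < card (pverts G) \<Longrightarrow> j < card (pverts G) \<Longrightarrow> adjacency G i j = adjacency H (\<sigma> i) (\<sigma> j)"
  shows "graph_isomorphic G H"
proof -
  interpret G: pair_graph G by fact
  interpret H: pair_graph H by fact
  let ?n = "card (pverts G)" and ?vs = "vertex_list G" and ?ws = "vertex_list H"
  note vs = vertex_list[OF G.pair_finite_verts] and ws = vertex_list[OF H.pair_finite_verts]
  have len: "length ?vs = ?n" "length ?ws = ?n"
    using distinct_card[OF vs(1)] distinct_card[OF ws(1)] vs ws card by auto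
  have bv: "bij_betw ((!) ?vs) {..<?n} (pverts G)" and bw: "bij_betw ((!) ?ws) {..<?n} (pverts H)"
    using bij_betw_nth[OF vs(1)] bij_betw_nth[OF ws(1)] vs ws len by auto
  let ?idx = "the_inv_into {..<?n} ((!) ?vs)"
  have idx: "bij_betw ?idx (pverts G) {..<?n}" by (rule bij_betw_the_inv_into[OF bv])
  have nth: "?vs ! ?idx u = u" if "u \<in> pverts G" for u
    using that bv by (simp add: bij_betw_def f_the_inv_into_f)
  have "bij_betw ((!) ?ws \<circ> (\<sigma> \<circ> ?idx)) (pverts G) (pverts H)"
    by (intro bij_betw_trans[OF _ bw] bij_betw_trans[OF idx bij])
  moreover have "(u, v) \<in> parcs G \<longleftrightarrow> (((!) ?ws \<circ> (\<sigma> \<circ> ?idx)) u, ((!) ?ws \<circ> (\<sigma> \<circ> ?idx)) v) \<in> parcs H"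
    if "u \<in> pverts G" "v \<in> pverts G" for u v
  proof -
    have iu: "?idx u < ?n" "?idx v < ?n" using that idx by (auto simp: bij_betw_def)
    then have "\<sigma> (?idx u) < ?n" "\<sigma> (?idx v) < ?n" using bij by (auto simp: bij_betw_def)
    then show ?thesis
      using eq[OF iu] iu nth that card by (simp add: adjacency_eq split: if_splits)
  qed
  ultimately show ?thesis using graph_isomorphic_iff[OF G H] by blast
qed

lemma walk_mat_entry:
  assumes "i < card (pverts G)" "k < card (pverts G)"
  shows "walk_mat G $$ (i, k) = (mat_op (card (pverts G)) (adjacency G) ^^ k) ones i"
proof -
  let ?n = "card (pverts G)"
  have "walk_mat G $$ (i, k) = (adjacency_mat G ^\<^sub>m k *\<^sub>v all_ones_vec ?n) $ i"
    using assms by (simp add: walk_mat_def Let_def mat_of_cols_index)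
  also have "\<dots> = (mat_op ?n (adjacency G) ^^ k) (\<lambda>j. all_ones_vec ?n $ j) i"
    by (rule pow_mat_mult_vec[OF adjacency_mat_carrier]) (use assms in \<open>auto simp: all_ones_vec_def\<close>)
  also have "\<dots> = (mat_op ?n (adjacency G) ^^ k) ones i"
    unfolding poly_op_monom[symmetric] by (rule poly_op_cong) (use assms in \<open>auto simp: all_ones_vec_def\<close>)
  finally show ?thesis .
qed

lemma generalized_cospectral_walk:
  assumes "generalized_cospectral G H"
  shows "card (pverts H) = card (pverts G)"
    and "walk_functional (card (pverts G)) (adjacency H) p = walk_functional (card (pverts G)) (adjacency G) p"
proof -
  let ?n = "card (pverts G)"
  note A = adjacency_mat_carrier[of G] and B = adjacency_mat_carrier[of H]
  have spec: "spectrum_mset (adjacency_mat G) = spectrum_mset (adjacency_mat H)"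
    "spectrum_mset (complement_mat G) = spectrum_mset (complement_mat H)"
    using assms by (simp_all add: generalized_cospectral_def generalized_spectrum_def)
  show n: "card (pverts H) = ?n" using spectrum_mset_eq_imp_char_poly_eq(2)[OF A B spec(1)] by simp
  have compl: "complement_mat K = mat (card (pverts K)) (card (pverts K)) (\<lambda>_. 1)
      - 1\<^sub>m (card (pverts K)) - adjacency_mat K" for K :: "'x pair_pre_digraph"
    by (simp add: complement_mat_def Let_def all_ones_mat_def)
  have compl_car: "complement_mat K \<in> carrier_mat (card (pverts K)) (card (pverts K))" for K :: "'x pair_pre_digraph"
    unfolding compl using adjacency_mat_carrier[of K] by auto
  have "char_poly (complement_mat H) = char_poly (complement_mat G)"
    using spectrum_mset_eq_imp_char_poly_eq(1)[OF compl_car compl_car spec(2)] by simp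
  then show "walk_functional ?n (adjacency H) p = walk_functional ?n (adjacency G) p"
    using A B spectrum_mset_eq_imp_char_poly_eq(1)[OF A B spec(1)]
    unfolding compl n by (intro walk_functional_eqI) simp_all
qed

section \<open>The Gram matrix of the walks\<close>

lemma walk_functional_linear:
  "walk_functional n a (\<Sum>j\<in>A. Polynomial.smult (c j) (p j)) = (\<Sum>j\<in>A. c j * walk_functional n a (p j))"
proof (induction A rule: infinite_finite_induct)
  case (insert x A)
  then show ?case
    by (simp add: walk_functional_def poly_op_add poly_op_smult inner_add_right inner_scale_right)
qed (simp_all add: walk_functional_def poly_op_0 inner_def)

definition gram_mat :: "nat \<Rightarrow> (nat \<Rightarrow> nat \<Rightarrow> int) \<Rightarrow> int mat" where
  "gram_mat n a = mat n n (\<lambda>(k, j). walk_functional n a (monom 1 (k + j)))"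

text \<open>The Gram matrix is W^T W, so its determinant is a square that vanishes exactly when W^T
  has a kernel. As its entries are walk counts, nonsingularity passes from G to its mates.\<close>

lemma (in sym_op) det_gram_mat_nonzero_iff:
  "det (gram_mat n a) \<noteq> 0 \<longleftrightarrow>
    (\<forall>y. (\<forall>k<n. inner n ((mat_op n a ^^ k) ones) y = 0) \<longrightarrow> (\<forall>i<n. y i = 0))"
proof -
  let ?X = "mat n n (\<lambda>(k, i). (mat_op n a ^^ k) ones i)"
  have X: "?X \<in> carrier_mat n n" by simp
  have "gram_mat n a = ?X * transpose_mat ?X"
  proof (rule eq_matI)
    fix k j assume "k < dim_row (?X * transpose_mat ?X)" "j < dim_col (?X * transpose_mat ?X)"
    then have "(?X * transpose_mat ?X) $$ (k, j) = inner n ((mat_op n a ^^ k) ones) ((mat_op n a ^^ j) ones)"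
      by (simp add: scalar_prod_def inner_def atLeast0LessThan)
    also have "\<dots> = walk_functional n a (monom 1 (k + j))"
      by (simp add: inner_funpow_shift walk_functional_def poly_op_monom inner_commute add.commute)
    finally show "gram_mat n a $$ (k, j) = (?X * transpose_mat ?X) $$ (k, j)"
      using \<open>k < _\<close> \<open>j < _\<close> by (simp add: gram_mat_def)
  qed (simp_all add: gram_mat_def)
  then have "det (gram_mat n a) = det ?X * det ?X"
    using det_mult[OF X, of "transpose_mat ?X"] det_transpose[OF X] by simp
  then have "det (gram_mat n a) \<noteq> 0 \<longleftrightarrow> \<not> (\<exists>v. v \<in> carrier_vec n \<and> v \<noteq> 0\<^sub>v n \<and> ?X *\<^sub>v v = 0\<^sub>v n)"
    using det_0_iff_vec_prod_zero[OF X] by simp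
  also have "\<dots> \<longleftrightarrow> (\<forall>y. (\<forall>k<n. inner n ((mat_op n a ^^ k) ones) y = 0) \<longrightarrow> (\<forall>i<n. y i = 0))"
  proof -
    have Xv: "?X *\<^sub>v vec n y = 0\<^sub>v n \<longleftrightarrow> (\<forall>k<n. inner n ((mat_op n a ^^ k) ones) y = 0)" for y
      by (auto simp: vec_eq_iff scalar_prod_def inner_def atLeast0LessThan)
    have zero: "vec n y = 0\<^sub>v n \<longleftrightarrow> (\<forall>i<n. y i = 0)" for y :: "nat \<Rightarrow> int" by (auto simp: vec_eq_iff)
    have "(\<exists>v. v \<in> carrier_vec n \<and> v \<noteq> 0\<^sub>v n \<and> ?X *\<^sub>v v = 0\<^sub>v n)
        \<longleftrightarrow> (\<exists>y. vec n y \<noteq> 0\<^sub>v n \<and> ?X *\<^sub>v vec n y = 0\<^sub>v n)"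
    proof
      assume "\<exists>v. v \<in> carrier_vec n \<and> v \<noteq> 0\<^sub>v n \<and> ?X *\<^sub>v v = 0\<^sub>v n"
      then obtain v where v: "v \<in> carrier_vec n" "v \<noteq> 0\<^sub>v n" "?X *\<^sub>v v = 0\<^sub>v n" by blast
      have "v = vec n (\<lambda>i. v $ i)" using v(1) by auto
      then show "\<exists>y. vec n y \<noteq> 0\<^sub>v n \<and> ?X *\<^sub>v vec n y = 0\<^sub>v n" using v by metis
    qed (use vec_carrier in blast)
    then show ?thesis unfolding Xv zero by blast
  qed
  finally show ?thesis .
qed

text \<open>Cramer's rule: the last column of the adjugate solves the Gram system whose right-hand
  side is the determinant times the last unit vector.\<close>

lemma walk_generator_exists:
  fixes a :: "nat \<Rightarrow> nat \<Rightarrow> int"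
  shows "\<exists>r. \<forall>k<n. walk_functional n a (monom 1 k * r) = (if k = n - 1 then det (gram_mat n a) else 0)"
proof (intro exI allI impI)
  fix k assume k: "k < n"
  have M: "gram_mat n a \<in> carrier_mat n n" by (simp add: gram_mat_def)
  note adj = adj_mat[OF M]
  let ?r = "\<Sum>j<n. Polynomial.smult (adj_mat (gram_mat n a) $$ (j, n - 1)) (monom 1 j)"
  have "monom 1 k * ?r = (\<Sum>j<n. Polynomial.smult (adj_mat (gram_mat n a) $$ (j, n - 1)) (monom 1 (k + j)))"
    by (simp add: sum_distrib_left mult_monom)
  then have "walk_functional n a (monom 1 k * ?r)
      = (\<Sum>j<n. adj_mat (gram_mat n a) $$ (j, n - 1) * walk_functional n a (monom 1 (k + j)))"
    by (simp only: walk_functional_linear)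
  also have "\<dots> = (gram_mat n a * adj_mat (gram_mat n a)) $$ (k, n - 1)"
    using k adj(1) M by (simp add: scalar_prod_def atLeast0LessThan)
      (simp add: gram_mat_def mult.commute)
  also have "\<dots> = (if k = n - 1 then det (gram_mat n a) else 0)" unfolding adj(2) using k by simp
  finally show "walk_functional n a (monom 1 k * ?r) = (if k = n - 1 then det (gram_mat n a) else 0)" .
qed

lemma adjacency_walk_op:
  assumes G: "pair_graph G" and n: "card (pverts G) = n"
    and N: "N = det (gram_mat n (adjacency G))" "N \<noteq> 0"
    and r: "\<And>k. k < n \<Longrightarrow> walk_functional n (adjacency G) (monom 1 k * r) = (if k = n - 1 then N else 0)"
  shows "walk_op n (adjacency G) r N"
proof -
  interpret sym_op n "adjacency G" using adjacency_sym[OF G] n by simp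
  have A: "adjacency_mat G \<in> carrier_mat n n" using adjacency_mat_carrier n by metis
  show ?thesis
  proof
    show "N \<noteq> 0" by fact
    show "y i = 0"
      if "\<And>k. k < n \<Longrightarrow> inner n ((mat_op n (adjacency G) ^^ k) ones) y = 0" "i < n" for y i
      using det_gram_mat_nonzero_iff N that by blast
    show "\<exists>c. \<forall>i<n. (mat_op n (adjacency G) ^^ n) ones i = (\<Sum>k<n. c k * (mat_op n (adjacency G) ^^ k) ones i)"
      by (rule exI[of _ "\<lambda>k. - coeff (char_poly (adjacency_mat G)) k"])
        (use adj_char_poly_matrix_coeff(2)[OF A] in blast)
  qed (rule r)
qed

lemma graph_isomorphic_if_lattice_ideal_eq:
  assumes G: "pair_graph G" "card (pverts G) = n" "walk_op n (adjacency G) r N"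
    and H: "pair_graph H" "card (pverts H) = n" "walk_op n (adjacency H) r N"
    and walk: "\<And>p. walk_functional n (adjacency G) p = walk_functional n (adjacency H) p"
    and eq: "walk_op.lattice_ideal n (adjacency G) r N = walk_op.lattice_ideal n (adjacency H) r N"
  shows "graph_isomorphic G H"
proof -
  obtain \<sigma> where "bij_betw \<sigma> {..<n} {..<n}"
    "\<And>i j. i < n \<Longrightarrow> j < n \<Longrightarrow> adjacency G i j = adjacency H (\<sigma> i) (\<sigma> j)"
    using lattice_ideal_subset_imp_permutation[OF G(3) H(3) walk eq[THEN equalityD1]] by blast
  then show ?thesis
    using G H by (intro graph_isomorphic_if_adjacency_permuted[of G H \<sigma>]) simp_all
qed

theorem theorem1p6:
  fixes n :: nat
    and G :: "'a pair_pre_digraph"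
    and H\<^sub>1 :: "'b pair_pre_digraph"
    and H\<^sub>2 :: "'c pair_pre_digraph"
  assumes "n > 0"
    and "G \<in> graph_family n"
    and "generalized_cospectral_mate G H\<^sub>1"
    and "generalized_cospectral_mate G H\<^sub>2"
  shows "graph_isomorphic H\<^sub>1 H\<^sub>2"
proof -
  have G: "pair_graph G" and n: "card (pverts G) = n" using assms(2) by (auto simp: graph_family_def)
  have H: "pair_graph H\<^sub>1" "pair_graph H\<^sub>2" and cosp: "generalized_cospectral G H\<^sub>1" "generalized_cospectral G H\<^sub>2"
    and non_iso: "\<not> graph_isomorphic G H\<^sub>1" "\<not> graph_isomorphic G H\<^sub>2"
    using assms(3,4) by (auto simp: generalized_cospectral_mate_def)
  note card1 = generalized_cospectral_walk(1)[OF cosp(1), unfolded n]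
    and card2 = generalized_cospectral_walk(1)[OF cosp(2), unfolded n]
    and walk1 = generalized_cospectral_walk(2)[OF cosp(1), unfolded n]
    and walk2 = generalized_cospectral_walk(2)[OF cosp(2), unfolded n]
  \<comment> \<open>For n = 1 the diagonal is [1] and 2 D does not occur; a one-vertex graph has no
    mate. From n = 2 on, (n + 1) div 2 \<le> n - 1, so the last diagonal entry is 2 D.\<close>
  have n2: "n \<ge> 2"
  proof (rule ccontr)
    assume "\<not> n \<ge> 2"
    then have n1: "n = 1" using assms(1) by simp
    have "graph_isomorphic G H\<^sub>1"
      by (rule graph_isomorphic_if_adjacency_permuted[OF G H(1), where \<sigma> = id])
        (use n n1 card1 adjacency_diag[OF G] adjacency_diag[OF H(1)] in auto)
    then show False using non_iso by blast
  qed
  let ?s = "\<lambda>p b i. if i < (n + 1) div 2 then 1 else if i < n - 1 then 2 else 2 * p\<^sup>2 * b :: int"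
  obtain p b :: int where pb: "prime p" "odd p" "odd b" "squarefree b" "\<not> p dvd b"
    and snf: "is_smith_normal_form (walk_mat G) (mk_diagonal (map (?s p b) [0..<n]))"
    using assms(2) by (auto simp: graph_family_def)
  define D where "D = p\<^sup>2 * b"
  have D_odd: "odd D" using pb by (simp add: D_def)
  then have D0: "D \<noteq> 0" by auto
  have W: "walk_mat G \<in> carrier_mat n n" by (auto simp: walk_mat_def Let_def n)
  let ?S = "mk_diagonal (map (?s p b) [0..<n])"
  obtain U V where U: "U \<in> carrier_mat n n" "invertible_mat U" and V: "V \<in> carrier_mat n n" "invertible_mat V"
    and S: "?S = U * walk_mat G * V"
    using snf W by (auto simp: is_smith_normal_form_def)
  have S_entry: "?S $$ (i, j) = (if i = j then ?s p b i else 0)" if "i < n" "j < n" for i j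
    using that by (subst mk_diagonal_index) auto
  have small: "?s p b i = 1 \<or> ?s p b i = 2" if "i < n - 1" for i using that by simp
  have last: "?s p b (n - 1) = 2 * D" using n2 by (simp add: D_def)
  note smith = smith_transpose_solvable[OF W U V S S_entry small last D0 assms(1)]
  have w: "inner n (\<lambda>i. walk_mat G $$ (i, k)) y = inner n ((mat_op n (adjacency G) ^^ k) ones) y" if "k < n" for k y
    using that n by (intro inner_cong) (auto simp: walk_mat_entry)
  interpret A: sym_op n "adjacency G" using adjacency_sym[OF G] n by simp
  define N where "N = det (gram_mat n (adjacency G))"
  have "N \<noteq> 0"
    unfolding N_def A.det_gram_mat_nonzero_iff using smith(3) w by metis
  obtain r where r: "\<And>k. k < n \<Longrightarrow>
      walk_functional n (adjacency G) (monom 1 k * r) = (if k = n - 1 then N else 0)"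
    using walk_generator_exists[of n "adjacency G"] unfolding N_def by blast
  have wG: "walk_op n (adjacency G) r N"
    by (rule adjacency_walk_op[OF G n N_def \<open>N \<noteq> 0\<close> r])
  have gram: "gram_mat n (adjacency H\<^sub>1) = gram_mat n (adjacency G)"
    "gram_mat n (adjacency H\<^sub>2) = gram_mat n (adjacency G)"
    by (simp_all add: gram_mat_def walk1 walk2)
  have w1: "walk_op n (adjacency H\<^sub>1) r N"
    by (rule adjacency_walk_op[OF H(1) card1 _ \<open>N \<noteq> 0\<close>]) (simp_all add: gram N_def walk1 r[unfolded N_def])
  have w2: "walk_op n (adjacency H\<^sub>2) r N"
    by (rule adjacency_walk_op[OF H(2) card2 _ \<open>N \<noteq> 0\<close>]) (simp_all add: gram N_def walk2 r[unfolded N_def])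
  interpret G: walk_op n "adjacency G" r N by (rule wG)
  obtain z0 where z0: "\<And>k. k < n \<Longrightarrow>
      inner n ((mat_op n (adjacency G) ^^ k) ones) z0 = 2 * D * (if k = n - 1 then 1 else 0)"
  proof -
    obtain y where "\<forall>k<n. inner n (\<lambda>i. walk_mat G $$ (i, k)) y = 2 * D * (if k = n - 1 then 1 else 0)"
      using smith(1)[of "\<lambda>k. if k = n - 1 then 1 else 0"] by blast
    then show ?thesis by (intro that[of y]) (simp add: w)
  qed
  obtain g h where gh: "inner n g h = 1" "\<And>k. k < n \<Longrightarrow> 2 * D dvd inner n ((mat_op n (adjacency G) ^^ k) ones) g"
    "\<And>y. (\<And>k. k < n \<Longrightarrow> 2 * D dvd inner n ((mat_op n (adjacency G) ^^ k) ones) y)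
      \<Longrightarrow> \<exists>c. \<forall>i<n. D dvd y i - c * g i"
  proof -
    obtain g h where gh: "inner n g h = 1" "\<forall>k<n. 2 * D dvd inner n (\<lambda>i. walk_mat G $$ (i, k)) g"
      "\<And>y. (\<forall>k<n. 2 * D dvd inner n (\<lambda>i. walk_mat G $$ (i, k)) y) \<Longrightarrow> \<exists>c. \<forall>i<n. D dvd y i - c * g i"
      using smith(2) by blast
    show ?thesis by (rule that[OF gh(1)]) (use gh(2,3) in \<open>simp_all add: w\<close>)
  qed
  have sw: "smith_walk_op n (adjacency G) r N D z0 g h"
    by unfold_locales (use adjacency_diag[OF G] n D_odd z0 gh in auto)
  show ?thesis
    using smith_walk_op_unique_mate[OF sw pb D_def w1 w2 walk1 walk2]
  proof (elim disjE)
    assume "walk_op.lattice_ideal n (adjacency G) r N = walk_op.lattice_ideal n (adjacency H\<^sub>1) r N"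
    then have "graph_isomorphic G H\<^sub>1"
      by (intro graph_isomorphic_if_lattice_ideal_eq[OF G n wG H(1) card1 w1]) (simp_all add: walk1)
    then show ?thesis using non_iso by blast
  next
    assume "walk_op.lattice_ideal n (adjacency G) r N = walk_op.lattice_ideal n (adjacency H\<^sub>2) r N"
    then have "graph_isomorphic G H\<^sub>2"
      by (intro graph_isomorphic_if_lattice_ideal_eq[OF G n wG H(2) card2 w2]) (simp_all add: walk2)
    then show ?thesis using non_iso by blast
  next
    assume "walk_op.lattice_ideal n (adjacency H\<^sub>1) r N = walk_op.lattice_ideal n (adjacency H\<^sub>2) r N"
    then show ?thesis
      by (intro graph_isomorphic_if_lattice_ideal_eq[OF H(1) card1 w1 H(2) card2 w2]) (simp_all add: walk1 walk2)
  qed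
qed

end
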